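(* Let $p>3$ be a prime, let $h=\frac{1}{2}\gcd(p-1,24)$, and let $k=hk'$ be a positive integer divisible by $h$. Put $m=\frac{p-1}{2h}$ and $K=\frac{k(p+1)}{12}$ (an integer), and let $r=K-\lfloor K/m\rfloor m$. Let $c\in\{0,1,\dots,m-1\}$ be the least non-negative residue modulo $m$ of $k'\cdot\left(\frac{12}{h}\right)^{-1}$, where $\left(\frac{12}{h}\right)^{-1}$ denotes the inverse of $\frac{12}{h}$ modulo $m$ (which exists since $\gcd(\frac{12}{h},m)=1$). Then the number $N$ of eta-quotients $\eta^{r_1}(z)\eta^{r_p}(pz)$ with $r_1,r_p\in\mathbb{Z}$ lying in $S_k(\Gamma_1(p))$ is: (1) if $c=r$, then $N=\frac{k(p+1)}{12\cdot\frac{p-1}{2h}}-1$; (2) if $c<r$, then $N=\left\lceil \frac{k(p+1)}{12\cdot\frac{p-1}{2h}}\right\rceil$; (3) if $c>r$, then $N=\left\lfloor \frac{k(p+1)}{12\cdot\frac{p-1}{2h}}\right\rfloor$.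
   Context: $\eta(z)=q^{1/24}\prod_{n\ge1}(1-q^n)$, $q=e^{2\pi iz}$, is the Dedekind eta-function; an eta-quotient of level $p$ here means a function $\eta^{r_1}(z)\eta^{r_p}(pz)$ with integer exponents. $\Gamma_1(p)$ is the group of matrices in $\mathrm{SL}_2(\mathbb{Z})$ congruent to $\begin{pmatrix}1&*\\0&1\end{pmatrix}$ modulo $p$. $S_k(\Gamma_1(p))$ is the space of weight $k$ cusp forms on $\Gamma_1(p)$: holomorphic functions on the upper half plane invariant under the weight $k$ slash action of $\Gamma_1(p)$ and vanishing at every cusp. *)

theory Defs
  imports
    "HOL-Complex_Analysis.Complex_Analysis"
    "HOL-Number_Theory.Number_Theory"
begin

definition upper_half_plane :: "complex set" where
  "upper_half_plane = {z. Im z > 0}"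

definition dedekind_eta :: "complex \<Rightarrow> complex" where
  "dedekind_eta z =
     exp (2 * of_real pi * \<i> * z / 24) * (\<Prod>n. 1 - exp (2 * of_real pi * \<i> * z) ^ Suc n)"

(* Functions on the upper half plane are represented as elements of
   "extensional upper_half_plane", so that two of them are equal in HOL iff they agree on the
   upper half plane. *)
definition eta_quotient :: "nat \<Rightarrow> int \<Rightarrow> int \<Rightarrow> complex \<Rightarrow> complex" where
  "eta_quotient p r1 rp =
     (\<lambda>z\<in>upper_half_plane. dedekind_eta z powi r1 * dedekind_eta (of_nat p * z) powi rp)"

definition SL2Z :: "(int ^ 2 ^ 2) set" where
  "SL2Z = {A. det A = 1}"

definition Gamma1 :: "nat \<Rightarrow> (int ^ 2 ^ 2) set" where
  "Gamma1 N = {A \<in> SL2Z. [A $ 1 $ 1 = 1] (mod int N) \<and> [A $ 2 $ 1 = 0] (mod int N) \<and>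
                          [A $ 2 $ 2 = 1] (mod int N)}"

definition slash :: "int \<Rightarrow> int ^ 2 ^ 2 \<Rightarrow> (complex \<Rightarrow> complex) \<Rightarrow> complex \<Rightarrow> complex" where
  "slash k A f z =
     (of_int (A $ 2 $ 1) * z + of_int (A $ 2 $ 2)) powi (- k) *
     f ((of_int (A $ 1 $ 1) * z + of_int (A $ 1 $ 2)) / (of_int (A $ 2 $ 1) * z + of_int (A $ 2 $ 2)))"

(* Every cusp is the image of infinity under some element of SL2Z, so vanishing at every cusp
   says that every SL2Z-translate of f tends to 0 as the imaginary part tends to infinity
   (uniformly in the real part). *)
definition vanishes_at_cusps :: "int \<Rightarrow> (complex \<Rightarrow> complex) \<Rightarrow> bool" where
  "vanishes_at_cusps k f \<longleftrightarrow>
     (\<forall>A\<in>SL2Z. (slash k A f \<longlongrightarrow> 0) (filtercomap Im at_top))"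

definition cusp_forms :: "int \<Rightarrow> (int ^ 2 ^ 2) set \<Rightarrow> (complex \<Rightarrow> complex) set" where
  "cusp_forms k G = {f \<in> extensional upper_half_plane.
     f holomorphic_on upper_half_plane \<and>
     (\<forall>A\<in>G. \<forall>z\<in>upper_half_plane. slash k A f z = f z) \<and>
     vanishes_at_cusps k f}"

definition cuspidal_eta_quotients :: "nat \<Rightarrow> int \<Rightarrow> (complex \<Rightarrow> complex) set" where
  "cuspidal_eta_quotients p k =
     {f. \<exists>r1 rp. f = eta_quotient p r1 rp} \<inter> cusp_forms k (Gamma1 p)"

end

theory Submission
  imports Defs "HOL-Real_Asymp.Real_Asymp"
begin

text \<open>An eta-quotient lies in \<open>S\<^sub>k(\<Gamma>\<^sub>1(p))\<close> iff \<open>r1 + rp = 2 * k\<close>, \<open>r1 + p * rp = 24 * s\<close> and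
  \<open>p * r1 + rp = 24 * (K - s)\<close> with \<open>0 < s < K\<close>, where \<open>s\<close> and \<open>K - s\<close> are the orders of vanishing at
  the two cusps of \<open>\<Gamma>\<^sub>0(p)\<close>. Such exponents correspond to the \<open>s\<close> in the residue class of \<open>c\<close>
  modulo \<open>m\<close>. Since \<open>r \<equiv> 2 * c\<close> modulo \<open>m\<close>, counting them gives the three cases, and \<open>c = r\<close>
  only happens for \<open>c = 0\<close>.

  The invariance under \<open>\<Gamma>\<^sub>1(p)\<close> avoids Dedekind sums and Jacobi symbols. The theta function
  divided by \<open>\<eta>\<^sup>3\<close> is a Jacobi form for \<open>SL\<^sub>2(\<int>)\<close> without multiplier, by Liouville's theorem. Its values
  at half periods yield \<open>\<eta>(- 1 / z)\<^sup>2 = - \<i> z \<eta>(z)\<^sup>2\<close>, hence the explicit character of \<open>\<eta>\<^sup>2\<close>, and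
  \<open>\<eta>(z) / \<eta>(p z)\<close> is the product of its values at \<open>g z\<close>, \<open>1 \<le> g \<le> (p - 1) / 2\<close>, for the lattice
  spanned by \<open>1\<close> and \<open>p z\<close>, times an even power of \<open>\<eta>(p z)\<close>.\<close>

section \<open>The infinite q-Pochhammer symbol\<close>

text \<open>The product starts at \<open>n = 0\<close>, so the eta product is
  \<open>qpoch q q\<close>, and the theta function uses \<open>qpoch x q\<close> and
  \<open>qpoch (q / x) q\<close>.\<close>

definition qpoch :: "complex \<Rightarrow> complex \<Rightarrow> complex" where
  "qpoch x q = (\<Prod>n. 1 - x * q ^ n)"

lemma qpoch_convergent: "norm q < 1 \<Longrightarrow> convergent_prod (\<lambda>n. 1 - x * q ^ n :: complex)"
  by (rule abs_convergent_prod_imp_convergent_prod)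
     (simp add: abs_convergent_prod_conv_summable norm_mult norm_power summable_mult summable_geometric)

lemma qpoch_LIMSEQ:
  assumes "norm q < 1"
  shows "(\<lambda>N. \<Prod>n<N. 1 - x * q ^ n) \<longlonglongrightarrow> qpoch x q"
  using convergent_prod_LIMSEQ[OF qpoch_convergent[OF assms, of x]]
  unfolding qpoch_def lessThan_Suc_atMost[symmetric] by (rule LIMSEQ_imp_Suc)

text \<open>On a small closed disc \<open>g\<close> is bounded by \<open>B\<close> and
  \<open>h\<close> by some \<open>r < 1\<close>, so the M-test with \<open>B * r ^ n\<close> gives
  uniform convergence of the partial products. Both arguments may vary: the Klein form varies the
  first one, eta varies both.\<close>

lemma qpoch_holomorphic:
  assumes S: "open S" and g: "g holomorphic_on S" and h: "h holomorphic_on S"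
    and h1: "\<And>z. z \<in> S \<Longrightarrow> norm (h z) < 1"
  shows "(\<lambda>z. qpoch (g z) (h z)) holomorphic_on S"
proof (rule holomorphic_uniform_sequence[OF S])
  show "(\<lambda>z. \<Prod>n<N. 1 - g z * h z ^ n) holomorphic_on S" for N
    by (intro holomorphic_intros g h)
next
  fix x assume "x \<in> S"
  then obtain d where d: "d > 0" "cball x d \<subseteq> S"
    using S open_contains_cball by blast
  have contg: "continuous_on (cball x d) g" and conth: "continuous_on (cball x d) h"
    using g h d holomorphic_on_imp_continuous_on continuous_on_subset by blast+
  obtain B where B: "\<And>z. z \<in> cball x d \<Longrightarrow> norm (g z) \<le> B"
    using compact_imp_bounded[OF compact_continuous_image[OF contg compact_cball]]
    unfolding bounded_iff by blast
  \<comment> \<open>The maximum of \<open>norm (h z)\<close> over the compact disc is attained,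
    which keeps \<open>r\<close> strictly below 1.\<close>
  obtain y where y: "y \<in> cball x d" "\<And>z. z \<in> cball x d \<Longrightarrow> norm (h z) \<le> norm (h y)"
    using continuous_attains_sup[of "cball x d" "\<lambda>z. norm (h z)"] d conth
    by (force intro: continuous_intros)
  define r where "r = norm (h y)"
  have r: "0 \<le> r" "r < 1" and hr: "\<And>z. z \<in> cball x d \<Longrightarrow> norm (h z) \<le> r"
    using y h1 d by (auto simp: r_def)
  have "uniformly_convergent_on (cball x d) (\<lambda>N z. \<Prod>n<N. 1 - g z * h z ^ n)"
  proof (rule uniformly_convergent_on_prod')
    show "uniformly_convergent_on (cball x d) (\<lambda>N z. \<Sum>n<N. norm (1 - g z * h z ^ n - 1))"
    proof (rule Weierstrass_m_test')
      show "norm (norm (1 - g z * h z ^ n - 1)) \<le> B * r ^ n" if "z \<in> cball x d" for n z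
      proof -
        have "0 \<le> B" using B[OF that] norm_ge_zero order_trans by blast
        then show ?thesis using B[OF that] hr[OF that]
          by (auto simp: norm_mult norm_power intro!: mult_mono power_mono)
      qed
      show "summable (\<lambda>n. B * r ^ n)"
        using r by (intro summable_mult summable_geometric) auto
    qed
  qed (auto intro!: continuous_intros contg conth)
  then obtain l where l: "uniform_limit (cball x d) (\<lambda>N z. \<Prod>n<N. 1 - g z * h z ^ n) l sequentially"
    by (auto simp: uniformly_convergent_on_def)
  have "l z = qpoch (g z) (h z)" if "z \<in> cball x d" for z
    using LIMSEQ_unique[OF tendsto_uniform_limitI[OF l that] qpoch_LIMSEQ] h1 d that by blast
  then have "uniform_limit (cball x d) (\<lambda>N z. \<Prod>n<N. 1 - g z * h z ^ n) (\<lambda>z. qpoch (g z) (h z)) sequentially"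
    using l by (subst uniform_limit_cong'[where g = "\<lambda>N z. \<Prod>n<N. 1 - g z * h z ^ n" and i = l]) auto
  then show "\<exists>d>0. cball x d \<subseteq> S \<and> uniform_limit (cball x d) (\<lambda>N z. \<Prod>n<N. 1 - g z * h z ^ n)
      (\<lambda>z. qpoch (g z) (h z)) sequentially"
    using d by blast
qed

lemma qpoch_rec:
  assumes "norm q < 1"
  shows "qpoch x q = (1 - x) * qpoch (q * x) q"
proof -
  have "(\<lambda>N. (1 - x) * (\<Prod>n<N. 1 - (q * x) * q ^ n)) \<longlonglongrightarrow> (1 - x) * qpoch (q * x) q"
    by (intro tendsto_intros qpoch_LIMSEQ assms)
  moreover have "(1 - x) * (\<Prod>n<N. 1 - (q * x) * q ^ n) = (\<Prod>n<Suc N. 1 - x * q ^ n)" for N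
    by (subst prod.lessThan_Suc_shift) (simp add: mult_ac)
  ultimately show ?thesis
    using LIMSEQ_Suc[OF qpoch_LIMSEQ[OF assms, of x]] LIMSEQ_unique by auto
qed

lemma qpoch_nonzero:
  assumes "norm q < 1" "\<And>n. x * q ^ n \<noteq> 1"
  shows "qpoch x q \<noteq> 0"
  unfolding qpoch_def by (rule prodinf_nonzero[OF qpoch_convergent[OF assms(1)]]) (use assms(2) in force)

lemma qpoch_self_nonzero:
  assumes "norm q < 1"
  shows "qpoch q q \<noteq> 0"
proof (rule qpoch_nonzero[OF assms])
  fix n
  have "norm (q * q ^ n) < 1"
    using power_Suc_less_one[of "norm q" n] assms
    by (metis norm_ge_zero norm_power power_Suc power_less_one_iff zero_less_Suc)
  then show "q * q ^ n \<noteq> 1" by auto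
qed

text \<open>Sort the factors by the residue of the exponent modulo \<open>p\<close>; the finite
  products agree after \<open>N * p\<close> factors, and the limit is taken along these.\<close>

lemma qpoch_multisection:
  assumes q: "norm q < 1" and p: "p > 0"
  shows "(\<Prod>g<p. qpoch (x * q ^ g) (q ^ p)) = qpoch x q"
proof -
  have qp: "norm (q ^ p) < 1"
    using q p by (simp add: norm_power power_less_one_iff)
  have "(\<lambda>N. \<Prod>g<p. \<Prod>n<N. 1 - (x * q ^ g) * (q ^ p) ^ n) \<longlonglongrightarrow> (\<Prod>g<p. qpoch (x * q ^ g) (q ^ p))"
    by (intro tendsto_prod qpoch_LIMSEQ qp)
  moreover have "(\<Prod>g<p. \<Prod>n<N. 1 - (x * q ^ g) * (q ^ p) ^ n) = (\<Prod>n<N * p. 1 - x * q ^ n)" for N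
  proof -
    have "(\<Prod>n<N * p. 1 - x * q ^ n) = (\<Prod>n<N. \<Prod>g\<in>{n * p..<n * p + p}. 1 - x * q ^ g)"
      using prod.nat_group[of "\<lambda>n. 1 - x * q ^ n" p N] by simp
    also have "\<dots> = (\<Prod>n<N. \<Prod>g<p. 1 - (x * q ^ g) * (q ^ p) ^ n)"
    proof (rule prod.cong[OF refl])
      fix n
      have "(\<Prod>g\<in>{n * p..<n * p + p}. 1 - x * q ^ g) = (\<Prod>g<p. 1 - x * q ^ (n * p + g))"
        by (rule prod.reindex_bij_witness[of _ "\<lambda>g. n * p + g" "\<lambda>g. g - n * p"]) auto
      then show "(\<Prod>g\<in>{n * p..<n * p + p}. 1 - x * q ^ g) = (\<Prod>g<p. 1 - (x * q ^ g) * (q ^ p) ^ n)"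
        by (simp add: power_add power_mult mult_ac flip: power_mult)
    qed
    finally show ?thesis by (subst prod.swap) simp
  qed
  moreover have "(\<lambda>N. \<Prod>n<N * p. 1 - x * q ^ n) \<longlonglongrightarrow> qpoch x q"
    using filterlim_compose[OF qpoch_LIMSEQ[OF q, of x], of "\<lambda>N. N * p"] p
    by (simp add: filterlim_subseq strict_mono_def)
  ultimately show ?thesis using LIMSEQ_unique by auto
qed

text \<open>The neighbourhood filter includes 0 itself, so this composes directly with limits such
  as \<open>epi_tendsto_0\<close>.\<close>

lemma qpoch_self_tendsto_1: "((\<lambda>q. qpoch q q) \<longlongrightarrow> 1) (nhds 0)"
proof -
  have "(\<lambda>q. qpoch q q) holomorphic_on ball 0 1"
    by (rule qpoch_holomorphic) auto
  then have "isCont (\<lambda>q. qpoch q q) 0"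
    by (metis centre_in_ball continuous_on_interior holomorphic_on_imp_continuous_on
        interior_ball zero_less_one)
  moreover have "qpoch 0 0 = 1" by (simp add: qpoch_def)
  ultimately show ?thesis
    by (metis (mono_tags, lifting) continuous_at tendsto_nhds_iff)
qed

section \<open>Elliptic functions and the Klein form\<close>

text \<open>Without the usual factor 2 in the exponent, \<open>epi\<close> has period 2 and the
  usual \<open>q\<close> is \<open>epi (2 * t)\<close>. Its square root \<open>epi t\<close> and the
  sign \<open>epi 1 = -1\<close> then need no choice of branch.\<close>

definition epi :: "complex \<Rightarrow> complex" where
  "epi w = exp (of_real pi * \<i> * w)"

lemma epi_add: "epi (v + w) = epi v * epi w"
  by (simp add: epi_def ring_distribs exp_add)

lemma epi_diff: "epi (v - w) = epi v / epi w"
  by (simp add: epi_def ring_distribs exp_diff)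

lemma epi_minus: "epi (- w) = inverse (epi w)"
  by (simp add: epi_def exp_minus)

lemma epi_0 [simp]: "epi 0 = 1"
  by (simp add: epi_def)

lemma epi_nonzero [simp]: "epi w \<noteq> 0"
  by (simp add: epi_def)

lemma epi_power: "epi w ^ n = epi (of_nat n * w)"
  by (simp add: epi_def exp_of_nat_mult[symmetric] mult_ac)

lemma epi_power_int: "epi w powi n = epi (of_int n * w)"
proof (cases "n \<ge> 0")
  case True
  then show ?thesis by (metis epi_power nonneg_eq_int of_int_of_nat_eq power_int_of_nat)
next
  case False
  then obtain n' where "n = - int n'" by (metis le_cases nonneg_eq_int minus_minus neg_0_le_iff_le)
  then show ?thesis by (simp add: power_int_minus power_int_of_nat epi_power epi_minus)
qed

lemma epi_sum: "finite A \<Longrightarrow> epi (\<Sum>i\<in>A. f i) = (\<Prod>i\<in>A. epi (f i))"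
  by (induction A rule: finite_induct) (auto simp: epi_add)

lemma epi_eq_1_iff: "epi w = 1 \<longleftrightarrow> (\<exists>n::int. w = 2 * of_int n)"
proof -
  have "epi w = 1 \<longleftrightarrow> (\<exists>n::int. of_real pi * \<i> * w = of_int (2 * n) * of_real pi * \<i>)"
    unfolding epi_def exp_eq_1 by (auto simp: complex_eq_iff)
  also have "\<dots> \<longleftrightarrow> (\<exists>n::int. w = 2 * of_int n)"
    by (auto simp: mult_ac)
  finally show ?thesis .
qed

lemma epi_even [simp]: "epi (2 * of_int n) = 1"
  using epi_eq_1_iff by blast

lemma epi_2 [simp]: "epi 2 = 1"
  using epi_even[of 1] by simp

lemma epi_1 [simp]: "epi 1 = -1"
  by (simp add: epi_def)

lemma epi_eqI:
  assumes "v = w + 2 * of_int n"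
  shows "epi v = epi w"
  by (simp add: assms epi_add)

lemma norm_epi: "norm (epi w) = exp (- pi * Im w)"
  by (simp add: epi_def)

lemma norm_epi_less_1: "Im w > 0 \<Longrightarrow> norm (epi (2 * w)) < 1"
  by (simp add: norm_epi)

lemma epi_holomorphic [holomorphic_intros]:
  "f holomorphic_on A \<Longrightarrow> (\<lambda>x. epi (f x)) holomorphic_on A"
  unfolding epi_def by (intro holomorphic_intros)

lemma epi_has_field_derivative [derivative_intros]:
  assumes "(f has_field_derivative f') (at x within A)"
  shows "((\<lambda>x. epi (f x)) has_field_derivative of_real pi * \<i> * f' * epi (f x)) (at x within A)"
  unfolding epi_def using assms by (auto intro!: derivative_eq_intros)

section \<open>Quasi-periodic entire functions and Liouville's theorem\<close>

definition period_lattice :: "complex \<Rightarrow> complex set" where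
  "period_lattice t = {of_int m * t + of_int n |m n. True}"

text \<open>The quotient \<open>N / D\<close> is doubly periodic because the cocycles agree. Its
  singularities at lattice points are removable, since \<open>D\<close> has simple zeros there and
  \<open>N\<close> vanishes, so it is a bounded entire function and hence constant; its value is
  read off at 0.\<close>

lemma quasi_elliptic_proportional:
  fixes N D :: "complex \<Rightarrow> complex" and \<mu> :: "int \<Rightarrow> int \<Rightarrow> complex \<Rightarrow> complex"
  assumes t: "Im t > 0"
    and N: "N holomorphic_on UNIV" and D: "D holomorphic_on UNIV"
    and Nq: "\<And>m n u. N (u + (of_int m * t + of_int n)) = \<mu> m n u * N u"
    and Dq: "\<And>m n u. D (u + (of_int m * t + of_int n)) = \<mu> m n u * D u"
    and \<mu>: "\<And>m n u. \<mu> m n u \<noteq> 0"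
    and Dz: "\<And>u. D u = 0 \<Longrightarrow> u \<in> period_lattice t"
    and "N 0 = 0" "D 0 = 0"
    and N': "(N has_field_derivative N') (at 0)" and D': "(D has_field_derivative D') (at 0)"
    and "D' \<noteq> 0"
  shows "N u = N' / D' * D u"
proof -
  have Lz: "N u = 0" "D u = 0" if "u \<in> period_lattice t" for u
    using that Nq[of 0] Dq[of 0] \<open>N 0 = 0\<close> \<open>D 0 = 0\<close> by (auto simp: period_lattice_def)
  \<comment> \<open>The default \<open>N' / D'\<close> is the limit of the quotient at 0 and, by
    periodicity, at every lattice point.\<close>
  define R where "R = (\<lambda>u. if D u = 0 then N' / D' else N u / D u)"
  have Rper: "R (u + (of_int m * t + of_int n)) = R u" for u m n
    using \<mu>[of m n u] by (simp add: R_def Nq Dq)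
  \<comment> \<open>The zero at 0 is divided out: near 0, \<open>R\<close> is a quotient of entire
    functions whose denominator takes the value \<open>D' \<noteq> 0\<close> at 0.\<close>
  define N1 where "N1 = (\<lambda>z. if z = 0 then deriv N 0 else (N z - N 0) / (z - 0))"
  define D1 where "D1 = (\<lambda>z. if z = 0 then deriv D 0 else (D z - D 0) / (z - 0))"
  have N1: "N1 holomorphic_on UNIV" and D1: "D1 holomorphic_on UNIV"
    unfolding N1_def D1_def by (intro pole_lemma_open N D open_UNIV)+
  have dN: "deriv N 0 = N'" and dD: "deriv D 0 = D'"
    using N' D' by (auto intro: DERIV_imp_deriv)
  have "isCont D1 0"
    using holomorphic_on_imp_continuous_on[OF D1] by (simp add: continuous_on_eq_continuous_at)
  then obtain e where e: "e > 0" "\<And>z. z \<in> ball 0 e \<Longrightarrow> D1 z \<noteq> 0"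
    using continuous_at_avoid[of 0 D1 0] dD \<open>D' \<noteq> 0\<close> by (force simp: D1_def)
  have Re: "R z = N1 z / D1 z" if "z \<in> ball 0 e" for z
    using e(2)[OF that] \<open>N 0 = 0\<close> \<open>D 0 = 0\<close> dN dD by (auto simp: R_def N1_def D1_def)
  have "(\<lambda>z. N1 z / D1 z) holomorphic_on ball 0 e"
    using e(2) by (intro holomorphic_intros holomorphic_on_subset[OF N1] holomorphic_on_subset[OF D1]) auto
  then have Re': "R holomorphic_on ball 0 e"
    using Re holomorphic_transform by (metis (no_types, lifting))
  have "\<exists>S. open S \<and> z \<in> S \<and> R holomorphic_on S" for z
  proof (cases "D z = 0")
    case True
    then obtain m n where z: "z = of_int m * t + of_int n" using Dz unfolding period_lattice_def by blast
    \<comment> \<open>Periodicity carries the local statement from 0 to the lattice point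
      \<open>z\<close>.\<close>
    have "(R \<circ> (\<lambda>w. w - z)) holomorphic_on ball z e"
      by (rule holomorphic_on_compose_gen[OF _ Re']) (auto intro!: holomorphic_intros simp: dist_norm norm_minus_commute)
    moreover have "R w = (R \<circ> (\<lambda>w. w - z)) w" for w
      using Rper[of "w - z" m n] by (simp add: z)
    ultimately have "R holomorphic_on ball z e"
      using holomorphic_transform by (metis (no_types, lifting))
    then show ?thesis using e by (intro exI[of _ "ball z e"]) auto
  next
    case False
    have "open {u. D u \<noteq> 0}"
      using holomorphic_on_imp_continuous_on[OF D]
      by (intro open_Collect_neq continuous_intros) auto
    moreover have "(\<lambda>u. N u / D u) holomorphic_on {u. D u \<noteq> 0}"
      by (intro holomorphic_intros holomorphic_on_subset[OF N] holomorphic_on_subset[OF D]) auto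
    then have "R holomorphic_on {u. D u \<noteq> 0}"
      by (rule holomorphic_transform) (auto simp: R_def)
    ultimately show ?thesis using False by blast
  qed
  then have Rh: "R holomorphic_on UNIV"
    by (metis UNIV_I at_within_open field_differentiable_at_within holomorphic_on_def)
  have cR: "continuous_on UNIV R" using Rh holomorphic_on_imp_continuous_on by blast
  \<comment> \<open>The closed period parallelogram is compact, and by periodicity \<open>R\<close>
    takes all its values on it.\<close>
  define Q where "Q = (\<lambda>(x::real, y::real). of_real x * t + of_real y) ` ({0..1} \<times> {0..1})"
  have "compact Q" unfolding Q_def
    by (intro compact_continuous_image compact_Times) (auto simp: split_beta intro!: continuous_intros)
  then have bQ: "bounded (R ` Q)"
    using cR by (meson compact_continuous_image compact_imp_bounded continuous_on_subset subset_UNIV)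
  have "R w \<in> R ` Q" for w
  proof -
    define y where "y = Im w / Im t"
    define x where "x = Re w - y * Re t"
    have w: "w = of_real y * t + of_real x"
      using t by (simp add: complex_eq_iff x_def y_def)
    define v where "v = of_real (frac y) * t + of_real (frac x)"
    have "v \<in> Q" unfolding v_def Q_def
      by (rule image_eqI[of _ _ "(frac y, frac x)"]) (auto simp: frac_ge_0 frac_lt_1 less_imp_le)
    moreover have "w = v + (of_int \<lfloor>y\<rfloor> * t + of_int \<lfloor>x\<rfloor>)"
      by (simp add: w v_def frac_def ring_distribs)
    then have "R w = R v" using Rper by metis
    ultimately show ?thesis by blast
  qed
  then have "bounded (range R)" using bQ by (metis bounded_subset image_subsetI)
  then have "R constant_on UNIV" using Rh Liouville_theorem by blast
  moreover have "R 0 = N' / D'" using \<open>D 0 = 0\<close> by (simp add: R_def)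
  ultimately have "R u = N' / D'" by (metis UNIV_I constant_on_def)
  then show ?thesis using Lz Dz by (cases "D u = 0") (auto simp: R_def field_simps)
qed

text \<open>Up to a constant, \<open>klein u t\<close> is the Jacobi theta function \<open>\<theta>\<^sub>1(u | t)\<close> divided by
  \<open>\<eta>(t)\<^sup>3\<close>. Its derivative at \<open>u = 0\<close> does not depend on \<open>t\<close>, which is why its modular
  transformation law below carries no root of unity.\<close>

definition klein :: "complex \<Rightarrow> complex \<Rightarrow> complex" where
  "klein u t = epi (- u) * qpoch (epi (2 * u)) (epi (2 * t)) * qpoch (epi (2 * t - 2 * u)) (epi (2 * t))
     / qpoch (epi (2 * t)) (epi (2 * t)) ^ 2"

lemma klein_holomorphic:
  assumes "Im t > 0"
  shows "(\<lambda>u. klein u t) holomorphic_on UNIV"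
  unfolding klein_def using norm_epi_less_1[OF assms] qpoch_self_nonzero
  by (intro holomorphic_intros qpoch_holomorphic) auto

lemma klein_add_1: "klein (u + 1) t = - klein u t"
proof -
  have "epi (2 * (u + 1)) = epi (2 * u)" by (rule epi_eqI[of _ _ 1]) simp
  moreover have "epi (2 * t - 2 * (u + 1)) = epi (2 * t - 2 * u)" by (rule epi_eqI[of _ _ "-1"]) simp
  moreover have "epi (- (u + 1)) = - epi (- u)" using epi_add[of "-u" "-1"] epi_minus[of 1] by simp
  ultimately show ?thesis by (simp add: klein_def)
qed

text \<open>The shift removes the factor \<open>1 - x\<close> from one product and adds
  \<open>1 - 1 / x\<close> to the other; the identity \<open>1 - 1 / x = - (1 - x) / x\<close>
  produces the cocycle.\<close>

lemma klein_add_period: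
  assumes "Im t > 0"
  shows "klein (u + t) t = epi (1 - t - 2 * u) * klein u t"
proof -
  define q where "q = epi (2 * t)"
  have q: "norm q < 1" using norm_epi_less_1[OF assms] by (simp add: q_def)
  define x where "x = epi (2 * u)"
  have x: "x \<noteq> 0" by (simp add: x_def)
  have 1: "epi (2 * (u + t)) = q * x" "epi (2 * t - 2 * u) = q * inverse x"
    "epi (2 * t - 2 * (u + t)) = inverse x"
    by (simp_all add: q_def x_def epi_add epi_diff ring_distribs mult_ac epi_minus divide_inverse)
  have A: "qpoch (q * x) q * qpoch (inverse x) q = - inverse x * (qpoch x q * qpoch (q * inverse x) q)"
    using x unfolding qpoch_rec[OF q, of x] qpoch_rec[OF q, of "inverse x"] by (simp add: field_simps)
  have "epi (- (u + t)) = epi (- u) * epi (- t)"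
    by (simp add: epi_add[symmetric])
  moreover have "epi (1 - t - 2 * u) = - (epi (- t) * inverse x)"
    by (simp add: epi_diff epi_minus x_def divide_inverse)
  moreover have "klein (u + t) t = epi (- (u + t)) * (qpoch (q * x) q * qpoch (inverse x) q) / qpoch q q ^ 2"
    unfolding klein_def 1 q_def[symmetric] by (simp add: mult.assoc)
  ultimately show ?thesis
    unfolding A klein_def 1 q_def[symmetric] x_def[symmetric] by simp
qed

lemma klein_add_int: "klein (u + of_int n) t = epi (of_int n) * klein u t"
proof (induction n rule: int_induct[where k = 0])
  case (step1 i)
  then show ?case using klein_add_1[of "u + of_int i" t] by (simp add: epi_add add_ac)
next
  case (step2 i)
  then show ?case using klein_add_1[of "u + of_int (i - 1)" t] by (simp add: epi_diff add_ac)
qed simp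

lemma klein_add_int_period:
  assumes "Im t > 0"
  shows "klein (u + of_int m * t) t = epi (of_int m - of_int m ^ 2 * t - 2 * of_int m * u) * klein u t"
proof (induction m rule: int_induct[where k = 0])
  case (step1 i)
  have "klein (u + of_int (i + 1) * t) t = klein ((u + of_int i * t) + t) t"
    by (simp add: ring_distribs add_ac)
  also have "\<dots> = epi (1 - t - 2 * (u + of_int i * t)) * epi (of_int i - of_int i ^ 2 * t - 2 * of_int i * u) * klein u t"
    using step1 klein_add_period[OF assms] by simp
  finally show ?case by (simp add: epi_add[symmetric] power2_eq_square ring_distribs algebra_simps)
next
  case (step2 i)
  have "klein (u + of_int i * t) t = klein ((u + of_int (i - 1) * t) + t) t"
    by (simp add: ring_distribs)
  also have "\<dots> = epi (1 - t - 2 * (u + of_int (i - 1) * t)) * klein (u + of_int (i - 1) * t) t"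
    using klein_add_period[OF assms] by simp
  finally have "klein (u + of_int (i - 1) * t) t =
      epi (of_int i - of_int i ^ 2 * t - 2 * of_int i * u) / epi (1 - t - 2 * (u + of_int (i - 1) * t)) * klein u t"
    using step2 by (simp add: field_simps)
  then show ?case by (simp add: epi_diff[symmetric] power2_eq_square algebra_simps)
qed simp

lemma klein_add_lattice:
  assumes "Im t > 0"
  shows "klein (u + (of_int m * t + of_int n)) t =
    epi (of_int m + of_int n - of_int m ^ 2 * t - 2 * of_int m * u) * klein u t"
  using klein_add_int[of "u + of_int m * t" n t] klein_add_int_period[OF assms, of u m]
  by (simp add: epi_add epi_diff add_ac)

lemma klein_0 [simp]: "Im t > 0 \<Longrightarrow> klein 0 t = 0"
  using qpoch_rec[OF norm_epi_less_1, of t 1] by (simp add: klein_def)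

text \<open>A convergent product vanishes only if one of its factors does, and
  \<open>epi_eq_1_iff\<close> shows that a vanishing factor of either product puts \<open>u\<close>
  into the lattice.\<close>

lemma klein_nonzero:
  assumes t: "Im t > 0" and u: "u \<notin> period_lattice t"
  shows "klein u t \<noteq> 0"
proof -
  have q: "norm (epi (2 * t)) < 1" using norm_epi_less_1[OF t] .
  have "epi (2 * u) * epi (2 * t) ^ n \<noteq> 1" for n
  proof
    assume "epi (2 * u) * epi (2 * t) ^ n = 1"
    then have "epi (2 * u + of_nat n * (2 * t)) = 1" by (simp add: epi_add epi_power)
    then obtain k :: int where "2 * u + of_nat n * (2 * t) = 2 * of_int k" using epi_eq_1_iff by blast
    then have "2 * u = 2 * (of_int k - of_nat n * t)" by (simp add: algebra_simps)
    then have "u = of_int k - of_nat n * t" by (metis mult_left_cancel zero_neq_numeral)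
    then have "u = of_int (- int n) * t + of_int k" by simp
    with u show False unfolding period_lattice_def by blast
  qed
  moreover have "epi (2 * t - 2 * u) * epi (2 * t) ^ n \<noteq> 1" for n
  proof
    assume "epi (2 * t - 2 * u) * epi (2 * t) ^ n = 1"
    then have "epi (2 * t - 2 * u + of_nat n * (2 * t)) = 1" by (simp add: epi_add epi_power)
    then obtain k :: int where "2 * t - 2 * u + of_nat n * (2 * t) = 2 * of_int k" using epi_eq_1_iff by blast
    then have "2 * u = 2 * ((of_nat n + 1) * t - of_int k)" by (simp add: algebra_simps)
    then have "u = (of_nat n + 1) * t - of_int k" by (metis mult_left_cancel zero_neq_numeral)
    then have "u = of_int (int n + 1) * t + of_int (- k)" by simp
    with u show False unfolding period_lattice_def by blast
  qed
  ultimately show ?thesis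
    using qpoch_nonzero[OF q] qpoch_self_nonzero[OF q] by (simp add: klein_def)
qed

lemma klein_deriv_0:
  assumes t: "Im t > 0"
  shows "((\<lambda>u. klein u t) has_field_derivative - (2 * of_real pi * \<i>)) (at 0)"
proof -
  define q where "q = epi (2 * t)"
  have q: "norm q < 1" using norm_epi_less_1[OF t] by (simp add: q_def)
  \<comment> \<open>This is \<open>klein\<close> without its vanishing factor
    \<open>1 - epi (2 * u)\<close>; the denominator of \<open>klein\<close> is exactly what makes
    \<open>G 0 = 1\<close>.\<close>
  define G where "G = (\<lambda>u. epi (- u) * qpoch (q * epi (2 * u)) q * qpoch (q * epi (- (2 * u))) q / qpoch q q ^ 2)"
  have "G holomorphic_on UNIV"
    unfolding G_def using q qpoch_self_nonzero[OF q]
    by (intro holomorphic_intros qpoch_holomorphic) auto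
  then obtain G' where G': "(G has_field_derivative G') (at 0)"
    by (metis UNIV_I field_differentiable_def holomorphic_on_def)
  have G0: "G 0 = 1" using qpoch_self_nonzero[OF q] by (simp add: G_def power2_eq_square)
  have eq: "(\<lambda>u. klein u t) = (\<lambda>u. (1 - epi (2 * u)) * G u)"
  proof
    show "klein u t = (1 - epi (2 * u)) * G u" for u
      using qpoch_rec[OF q, of "epi (2 * u)"]
      by (simp add: klein_def G_def q_def[symmetric] epi_diff epi_minus divide_inverse)
  qed
  have "((\<lambda>u. 1 - epi (2 * u)) has_field_derivative - (2 * of_real pi * \<i>)) (at 0)"
    by (auto intro!: derivative_eq_intros)
  from DERIV_mult[OF this G'] show ?thesis unfolding eq by (simp add: G0)
qed

section \<open>Moebius transformations and the Klein form\<close>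

lemma moebius_Im:
  fixes a b c d :: real and z :: complex
  assumes "a * d - b * c = 1" "Im z > 0"
  shows "c * z + d \<noteq> 0" "Im ((a * z + b) / (c * z + d)) = Im z / norm (c * z + d) ^ 2"
proof -
  have "c \<noteq> 0 \<or> d \<noteq> 0" using assms by auto
  then show nz: "c * z + d \<noteq> 0"
    using assms by (auto simp: complex_eq_iff)
  have "Im ((a * z + b) / (c * z + d)) = (a * d - b * c) * Im z / norm (c * z + d) ^ 2"
    unfolding cmod_power2 by (simp add: Im_divide field_simps)
  then show "Im ((a * z + b) / (c * z + d)) = Im z / norm (c * z + d) ^ 2"
    using assms by simp
qed

lemma moebius_Im_pos:
  fixes a b c d :: int and z :: complex
  assumes "a * d - b * c = 1" "Im z > 0"
  shows "of_int c * z + of_int d \<noteq> 0" "Im ((of_int a * z + of_int b) / (of_int c * z + of_int d)) > 0"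
proof -
  have *: "of_int a * of_int d - of_int b * of_int c = (1::real)"
    using arg_cong[OF assms(1), of real_of_int] by simp
  show 1: "of_int c * z + of_int d \<noteq> 0" using moebius_Im(1)[OF * assms(2)] by simp
  show "Im ((of_int a * z + of_int b) / (of_int c * z + of_int d)) > 0"
    using moebius_Im(2)[OF * assms(2)] 1 assms(2) by simp
qed

text \<open>Once the Gaussian factor is moved to the left, both sides are entire in \<open>u\<close>
  with the same cocycle for the lattice of \<open>z\<close> and the same derivative at 0, so
  \<open>quasi_elliptic_proportional\<close> identifies them.\<close>

lemma klein_moebius:
  fixes a b c d :: int
  assumes det: "a * d - b * c = 1" and z: "Im z > 0"
  defines "j \<equiv> of_int c * z + of_int d"
  shows "klein (u / j) ((of_int a * z + of_int b) / j) = inverse j * epi (of_int c * u ^ 2 / j) * klein u z"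
proof -
  define w where "w = (of_int a * z + of_int b) / j"
  have j: "j \<noteq> 0" and w: "Im w > 0"
    using moebius_Im_pos[OF det z] by (auto simp: j_def w_def)
  define N where "N = (\<lambda>u. j * epi (- (of_int c * u ^ 2 / j)) * klein (u / j) w)"
  have "N u = - (2 * of_real pi * \<i>) / - (2 * of_real pi * \<i>) * klein u z"
  proof (rule quasi_elliptic_proportional[where N = N and D = "\<lambda>u. klein u z" and u = u and t = z and
        \<mu> = "\<lambda>m n u. epi (of_int m + of_int n - of_int m ^ 2 * z - 2 * of_int m * u)"])
    have "((\<lambda>u. klein u w) \<circ> (\<lambda>u. u / j)) holomorphic_on UNIV"
      by (rule holomorphic_on_compose_gen[OF _ klein_holomorphic[OF w]]) (auto intro!: holomorphic_intros j)
    then show "N holomorphic_on UNIV"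
      unfolding N_def o_def by (intro holomorphic_intros j) auto
    show "N (u + (of_int m * z + of_int n)) = epi (of_int m + of_int n - of_int m ^ 2 * z - 2 * of_int m * u) * N u" for m n u
    proof -
      \<comment> \<open>Coordinates of the lattice vector \<open>l\<close> in the basis
        \<open>a * z + b\<close>, \<open>j\<close>, so that
        \<open>l / j = m' * w + n'\<close>.\<close>
      define m' n' where "m' = m * d - n * c" and "n' = n * a - m * b"
      define l where "l = of_int m * z + of_int n"
      have m'l: "of_int m' + of_int c * l = of_int m * j"
        by (simp add: m'_def l_def j_def ring_distribs)
      have mn: "m = m' * a + n' * c" "n = m' * b + n' * d"
      proof -
        have "m' * a + n' * c = m * (a * d - b * c)" by (simp add: m'_def n'_def algebra_simps)
        then show "m = m' * a + n' * c" using det by simp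
        have "m' * b + n' * d = n * (a * d - b * c)" by (simp add: m'_def n'_def algebra_simps)
        then show "n = m' * b + n' * d" using det by simp
      qed
      have "l = of_int m' * (of_int a * z + of_int b) + of_int n' * j"
        unfolding l_def j_def by (subst mn(1), subst mn(2)) (simp add: ring_distribs)
      then have lj: "of_int m' * w = (l - of_int n' * j) / j"
        using j by (simp add: w_def field_simps)
      have shift: "(u + l) / j = u / j + (of_int m' * w + of_int n')"
        using j lj by (simp add: field_simps)
      \<comment> \<open>Writing \<open>m ^ 2 * z = m * l - m * n\<close> turns the sign of the
        cocycle into the parity of \<open>m + n + m * n\<close>. This is even only if
        \<open>m\<close> and \<open>n\<close> both are, a condition preserved by a base change of
        determinant 1.\<close>
      have "odd (a * d - b * c)" using det by simp
      then have "even (m' + n' + m' * n' - m - n - m * n)"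
        unfolding mn by (simp; blast)
      then obtain k where k: "m' + n' + m' * n' - m - n - m * n = 2 * k" by (elim evenE)
      have k': "of_int m' + of_int n' + of_int m' * of_int n' - of_int m - of_int n - of_int m * of_int n = (2 * of_int k :: complex)"
        using arg_cong[OF k, of "of_int :: int \<Rightarrow> complex"] by simp
      have "N (u + l) = j * (epi (- (of_int c * (u + l) ^ 2 / j)) *
          epi (of_int m' + of_int n' - of_int m' ^ 2 * w - 2 * of_int m' * (u / j))) * klein (u / j) w"
        unfolding N_def shift klein_add_lattice[OF w] by simp
      also have "epi (- (of_int c * (u + l) ^ 2 / j)) * epi (of_int m' + of_int n' - of_int m' ^ 2 * w - 2 * of_int m' * (u / j))
        = epi (of_int m + of_int n - of_int m ^ 2 * z - 2 * of_int m * u + - (of_int c * u ^ 2 / j))"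
      proof (subst epi_add[symmetric], rule epi_eqI[where n = k])
        have A: "of_int m' ^ 2 * w = of_int m' * ((l - of_int n' * j) / j)"
          unfolding lj[symmetric] by (simp add: power2_eq_square)
        have "- (of_int c * (u + l) ^ 2 / j) + (of_int m' + of_int n' - of_int m' ^ 2 * w - 2 * of_int m' * (u / j))
          = - (of_int c * u ^ 2 / j) + of_int m' + of_int n' + of_int m' * of_int n'
            - (2 * u + l) * ((of_int m' + of_int c * l) / j)"
          unfolding A using j by (simp add: field_simps power2_eq_square)
        also have "(of_int m' + of_int c * l) / j = of_int m" unfolding m'l using j by simp
        finally show "- (of_int c * (u + l) ^ 2 / j) + (of_int m' + of_int n' - of_int m' ^ 2 * w - 2 * of_int m' * (u / j))
          = of_int m + of_int n - of_int m ^ 2 * z - 2 * of_int m * u + - (of_int c * u ^ 2 / j) + 2 * of_int k"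
          unfolding k'[symmetric] by (simp add: l_def algebra_simps power2_eq_square)
      qed
      finally show ?thesis unfolding l_def[symmetric] N_def epi_add by (simp only: mult_ac)
    qed
    show "((\<lambda>u. N u) has_field_derivative - (2 * of_real pi * \<i>)) (at 0)"
      unfolding N_def using klein_deriv_0[OF w] j w
      by (auto intro!: derivative_eq_intros DERIV_chain2[where f = "\<lambda>u. klein u w"])
  qed (use z w klein_nonzero klein_add_lattice[OF z] klein_holomorphic klein_deriv_0 in \<open>auto simp: N_def\<close>)
  then show ?thesis using j by (simp add: N_def w_def epi_minus field_simps)
qed

section \<open>Modular transformation of the eta function\<close>

lemma dedekind_eta_eq: "dedekind_eta z = epi (z / 12) * qpoch (epi (2 * z)) (epi (2 * z))"
  by (simp add: dedekind_eta_def epi_def qpoch_def mult_ac)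

lemma dedekind_eta_nonzero: "Im z > 0 \<Longrightarrow> dedekind_eta z \<noteq> 0"
  using qpoch_self_nonzero[OF norm_epi_less_1] by (simp add: dedekind_eta_eq)

lemma open_upper_half_plane: "open upper_half_plane"
  unfolding upper_half_plane_def by (simp add: open_halfspace_Im_gt)

lemma dedekind_eta_holomorphic: "dedekind_eta holomorphic_on upper_half_plane"
  unfolding dedekind_eta_eq
  by (intro holomorphic_intros qpoch_holomorphic open_upper_half_plane)
     (auto simp: upper_half_plane_def norm_epi_less_1)

lemma dedekind_eta_add_int: "dedekind_eta (z + of_int n) = epi (of_int n / 12) * dedekind_eta z"
proof -
  have "epi (2 * (z + of_int n)) = epi (2 * z)" by (rule epi_eqI[of _ _ n]) simp
  then show ?thesis by (simp add: dedekind_eta_eq add_divide_distrib epi_add)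
qed

lemma epi_tendsto_0: "(epi \<longlongrightarrow> 0) (filtercomap Im at_top)"
proof -
  have "((\<lambda>y::real. exp (- pi * y)) \<longlongrightarrow> 0) at_top" by real_asymp
  then have "((\<lambda>z. norm (epi z)) \<longlongrightarrow> 0) (filtercomap Im at_top)"
    unfolding norm_epi by (rule filterlim_compose) (rule filterlim_filtercomap)
  then show ?thesis by (rule tendsto_norm_zero_cancel)
qed

lemma dedekind_eta_asymp:
  assumes "filterlim (\<lambda>x. Im (f x)) at_top F"
  shows "((\<lambda>x. dedekind_eta (f x) / epi (f x / 12)) \<longlongrightarrow> 1) F"
proof -
  have "filterlim (\<lambda>x. 2 * f x) (filtercomap Im at_top) F"
    unfolding filterlim_filtercomap_iff
    using filterlim_tendsto_pos_mult_at_top[OF tendsto_const, of 2, OF _ assms] by (simp add: o_def)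
  then have "((\<lambda>x. epi (2 * f x)) \<longlongrightarrow> 0) F" by (rule filterlim_compose[OF epi_tendsto_0])
  then have "((\<lambda>x. qpoch (epi (2 * f x)) (epi (2 * f x))) \<longlongrightarrow> 1) F"
    by (rule filterlim_compose[OF qpoch_self_tendsto_1])
  then show ?thesis by (simp add: dedekind_eta_eq)
qed

section \<open>Half-period values and the inversion\<close>

lemma qpoch_mult_minus:
  assumes "norm q < 1"
  shows "qpoch x q * qpoch (- x) q = qpoch (x ^ 2) (q ^ 2)"
proof -
  have "norm (q ^ 2) < 1" using assms by (simp add: norm_power power_less_one_iff)
  then have 1: "(\<lambda>N. \<Prod>n<N. 1 - x ^ 2 * (q ^ 2) ^ n) \<longlonglongrightarrow> qpoch (x ^ 2) (q ^ 2)"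
    by (rule qpoch_LIMSEQ)
  have "(\<lambda>N. (\<Prod>n<N. 1 - x * q ^ n) * (\<Prod>n<N. 1 - (- x) * q ^ n)) \<longlonglongrightarrow> qpoch x q * qpoch (- x) q"
    by (intro tendsto_mult qpoch_LIMSEQ assms)
  moreover have "(1 - x * q ^ n) * (1 - (- x) * q ^ n) = 1 - x ^ 2 * (q ^ 2) ^ n" for n
    by (simp add: algebra_simps power2_eq_square power_mult_distrib)
  ultimately show ?thesis using LIMSEQ_unique[OF 1] by (simp add: prod.distrib[symmetric])
qed

text \<open>Here \<open>x = -1\<close>, so up to a factor 2 both products are those of
  \<open>1 + q ^ n\<close>, which \<open>(1 - q ^ n) * (1 + q ^ n) = 1 - q ^ (2 * n)\<close>
  converts into eta values at \<open>2 * t\<close> and \<open>t\<close>.\<close>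

lemma klein_half:
  assumes t: "Im t > 0"
  shows "klein (1 / 2) t = - 2 * \<i> * dedekind_eta (2 * t) ^ 2 / dedekind_eta t ^ 4"
proof -
  define q where "q = epi (2 * t)"
  have q: "norm q < 1" using norm_epi_less_1[OF t] by (simp add: q_def)
  have nz: "qpoch q q \<noteq> 0" by (rule qpoch_self_nonzero[OF q])
  have e: "epi (- (1 / 2)) = - \<i>"
    by (simp add: epi_def exp_eq_polar complex_eq_iff cis.simps)
  have 1: "qpoch (- 1) q = 2 * qpoch (- q) q" using qpoch_rec[OF q, of "-1"] by simp
  have 2: "qpoch (- q) q = qpoch (q ^ 2) (q ^ 2) / qpoch q q"
    using qpoch_mult_minus[OF q, of q] nz by (simp add: field_simps)
  have q2: "q ^ 2 = epi (2 * (2 * t))" by (simp add: q_def epi_power)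
  have "epi (2 * t - 2 * (1 / 2)) = - q" by (simp add: q_def epi_diff)
  then have "klein (1 / 2) t = - 2 * \<i> * qpoch (q ^ 2) (q ^ 2) ^ 2 / qpoch q q ^ 4"
    unfolding klein_def q_def[symmetric] e using nz
    by (simp add: 1 2) (simp add: field_simps power2_eq_square power4_eq_xxxx)
  moreover have "dedekind_eta (2 * t) ^ 2 = epi (t / 3) * qpoch (q ^ 2) (q ^ 2) ^ 2"
    "dedekind_eta t ^ 4 = epi (t / 3) * qpoch q q ^ 4"
    by (simp_all add: dedekind_eta_eq q2 q_def power_mult_distrib epi_power)
  ultimately show ?thesis by simp
qed

text \<open>Here both products run over the odd powers of \<open>x = epi t\<close>; completing each
  with the even powers gives the eta product at \<open>t / 2\<close>.\<close>

lemma klein_half_period: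
  assumes t: "Im t > 0"
  shows "klein (t / 2) t = epi (- t / 4) * dedekind_eta (t / 2) ^ 2 / dedekind_eta t ^ 4"
proof -
  define x where "x = epi t"
  have x: "norm x < 1" using t by (simp add: x_def norm_epi)
  have q: "epi (2 * t) = x ^ 2" by (simp add: x_def epi_power)
  have nz: "qpoch (x ^ 2) (x ^ 2) \<noteq> 0" by (rule qpoch_self_nonzero) (simp add: norm_power power_less_one_iff x)
  have "qpoch x (x ^ 2) * qpoch (x ^ 2) (x ^ 2) = qpoch x x"
    using qpoch_multisection[OF x, of 2 x] by (simp add: numeral_2_eq_2 power2_eq_square mult_ac)
  then have 2: "qpoch x (x ^ 2) = qpoch x x / qpoch (x ^ 2) (x ^ 2)" using nz by (simp add: field_simps)
  have "epi (2 * (t / 2)) = x" "epi (2 * t - 2 * (t / 2)) = x" by (simp_all add: x_def)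
  then have "klein (t / 2) t = epi (- (t / 2)) * qpoch x x ^ 2 / qpoch (x ^ 2) (x ^ 2) ^ 4"
    unfolding klein_def q using nz by (simp add: 2) (simp add: field_simps power2_eq_square power4_eq_xxxx)
  moreover have "dedekind_eta (t / 2) ^ 2 = epi (t / 12) * qpoch x x ^ 2"
    by (simp add: dedekind_eta_eq x_def power_mult_distrib epi_power)
  moreover have "dedekind_eta t ^ 4 = epi (t / 3) * qpoch (x ^ 2) (x ^ 2) ^ 4"
    by (simp add: dedekind_eta_eq q power_mult_distrib epi_power)
  moreover have "epi (- (t / 2)) = epi (- t / 4) * epi (t / 12) / epi (t / 3)"
    unfolding epi_add[symmetric] epi_diff[symmetric] by (simp add: algebra_simps)
  ultimately show ?thesis by simp
qed

lemma Im_minus_inverse_pos: "Im z > 0 \<Longrightarrow> Im (- 1 / z) > 0"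
  using moebius_Im_pos(2)[of 0 0 "-1" 1 z] by simp

text \<open>The ratio \<open>y t\<close> of both sides satisfies \<open>y (t / 2) = (y t)\<^sup>2\<close> (compare two
  values of \<open>klein\<close> at half periods) and \<open>y (- 1 / t) = 1 / y t\<close>. Together these force
  \<open>(y t)\<^sup>3 = 1\<close>, so \<open>y\<close> is constant by continuity.\<close>

lemma dedekind_eta_S:
  assumes t: "Im t > 0"
  shows "dedekind_eta (- 1 / t) ^ 2 = - \<i> * t * dedekind_eta t ^ 2"
proof -
  define y where "y = (\<lambda>t. (dedekind_eta (- 1 / t) / dedekind_eta t) ^ 2 * \<i> / t)"
  have nz: "t \<noteq> 0" "dedekind_eta t \<noteq> 0" "dedekind_eta (- 1 / t) \<noteq> 0" if "Im t > 0" for t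
    using that dedekind_eta_nonzero Im_minus_inverse_pos by auto
  have A: "y (t / 2) = y t ^ 2" if t: "Im t > 0" for t
  proof -
    have s: "Im (- 1 / t) > 0" "Im (t / 2) > 0" using Im_minus_inverse_pos[OF t] t by auto
    \<comment> \<open>The inversion sends the half period \<open>t / 2\<close> to
      \<open>1 / 2\<close>, which links the two closed forms above.\<close>
    have "klein (t / 2 / t) (- 1 / t) = inverse t * epi ((t / 2) ^ 2 / t) * klein (t / 2) t"
      using klein_moebius[of 0 0 "-1" 1 t "t / 2"] t by simp
    also have "t / 2 / t = 1 / 2" using nz[OF t] by simp
    also have "(t / 2) ^ 2 / t = t / 4" using nz[OF t] by (simp add: power2_eq_square)
    finally have "- 2 * \<i> * dedekind_eta (2 * (- 1 / t)) ^ 2 / dedekind_eta (- 1 / t) ^ 4 =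
        inverse t * (epi (t / 4) * epi (- t / 4)) * dedekind_eta (t / 2) ^ 2 / dedekind_eta t ^ 4"
      unfolding klein_half[OF s(1)] klein_half_period[OF t] by simp
    also have "epi (t / 4) * epi (- t / 4) = 1" unfolding epi_add[symmetric] by simp
    also have "2 * (- 1 / t) = - 1 / (t / 2)" by simp
    finally have "(dedekind_eta (- 1 / (t / 2)) / dedekind_eta (t / 2)) ^ 2 * (- 2 * \<i> * t)
        = (dedekind_eta (- 1 / t) / dedekind_eta t) ^ 4"
      using nz[OF t] nz[OF s(2)] by (simp add: field_simps)
    moreover have "y (t / 2) * t ^ 2 * (-1) = (dedekind_eta (- 1 / (t / 2)) / dedekind_eta (t / 2)) ^ 2 * (- 2 * \<i> * t)"
      unfolding y_def using nz[OF t] by (simp add: power2_eq_square)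
    moreover have "y t ^ 2 * t ^ 2 * (-1) = (dedekind_eta (- 1 / t) / dedekind_eta t) ^ 4"
      unfolding y_def using nz[OF t] by (simp add: power_mult_distrib power_divide flip: power_mult)
    ultimately have "y (t / 2) * (t ^ 2 * (-1)) = y t ^ 2 * (t ^ 2 * (-1))" by (simp only: mult_ac)
    then show ?thesis using nz[OF t] by simp
  qed
  have B: "y (- 1 / t) * y t = 1" if t: "Im t > 0" for t
    using nz[OF t] by (simp add: y_def power_divide)
  have C: "y t ^ 3 = 1" if t: "Im t > 0" for t
  proof -
    have s: "Im (- 1 / t) > 0" "Im (2 * t) > 0" using Im_minus_inverse_pos[OF t] t by auto
    have y0: "y t \<noteq> 0" using B[OF t] by auto
    \<comment> \<open>The relation \<open>A\<close> at \<open>2 * t\<close> gives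
      \<open>y t = y (2 * t) ^ 2\<close>; at \<open>- 1 / t\<close>, combined with \<open>B\<close>,
      it gives \<open>y (2 * t) = y t ^ 2\<close>. Hence \<open>y t = y t ^ 4\<close>.\<close>
    have 1: "y t = y (2 * t) ^ 2" using A[OF s(2)] by simp
    have "y (- 1 / (2 * t)) = y (- 1 / t) ^ 2" using A[OF s(1)] by (simp add: mult.commute)
    moreover have "y (- 1 / (2 * t)) * y (2 * t) = 1" by (rule B[OF s(2)])
    ultimately have "y (- 1 / t) ^ 2 * y (2 * t) = 1" by simp
    then have "(y (- 1 / t) * y t) ^ 2 * y (2 * t) = y t ^ 2" by (simp add: power_mult_distrib)
    then have "y (2 * t) = y t ^ 2" unfolding B[OF t] by simp
    then have "y t * 1 = y t * y t ^ 3" using 1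
      by (metis mult.right_neutral mult_2 numeral_3_eq_3 power_Suc power_add power_even_eq power_one_right one_add_one
        numeral_2_eq_2 power2_eq_square mult.assoc)
    then show ?thesis using y0 by simp
  qed
  have "continuous_on upper_half_plane y"
    unfolding y_def
    by (intro continuous_intros continuous_on_compose2[OF holomorphic_on_imp_continuous_on[OF dedekind_eta_holomorphic]])
       (auto simp: upper_half_plane_def nz dest: Im_minus_inverse_pos)
  moreover have "connected upper_half_plane"
    unfolding upper_half_plane_def by (intro convex_connected convex_halfspace_Im_gt)
  \<comment> \<open>A continuous function with finitely many values on a connected set is constant;
    the fixed point \<open>\<i>\<close> of the inversion supplies the value 1.\<close>
  moreover have "finite (y ` upper_half_plane)"
    by (rule finite_subset[OF _ finite_nth_roots[of 3 1]]) (auto simp: upper_half_plane_def C)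
  ultimately have "y constant_on upper_half_plane"
    using continuous_finite_range_constant by blast
  then have "y t = y \<i>" using t by (auto simp: constant_on_def upper_half_plane_def)
  also have "y \<i> = 1" using dedekind_eta_nonzero[of \<i>] by (simp add: y_def)
  finally have "dedekind_eta (- 1 / t) ^ 2 * \<i> = t * dedekind_eta t ^ 2"
    using nz[OF t] by (simp add: y_def power_divide field_simps)
  then have "\<i> * (dedekind_eta (- 1 / t) ^ 2 * \<i>) = \<i> * (t * dedekind_eta t ^ 2)" by simp
  then show ?thesis by (simp add: algebra_simps flip: power2_eq_square mult.assoc)
       (metis add.inverse_inverse)
qed

text \<open>Dedekind's multiplier for the square of the eta function, as an exponent of
  \<open>exp (2 * pi * \<i> / 12)\<close>. Being polynomial, it depends on the matrix modulo 12 only.\<close>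

definition eta2_exponent :: "int \<Rightarrow> int \<Rightarrow> int \<Rightarrow> int \<Rightarrow> int" where
  "eta2_exponent a b c d = (1 - c ^ 2) * (b * d + 3 * (c - 1) * d + c + 3) + c * (a + d - 3)"

lemma eta2_exponent_cong:
  assumes "[a = a'] (mod M)" "[b = b'] (mod M)" "[c = c'] (mod M)" "[d = d'] (mod M)"
  shows "[eta2_exponent a b c d = eta2_exponent a' b' c' d'] (mod M)"
  unfolding eta2_exponent_def using assms
  by (intro cong_add cong_diff cong_mult cong_pow cong_refl)

text \<open>For a concrete modulus the last hypothesis is a finite computation.\<close>

lemma dvd_by_residues:
  fixes f g :: "int \<Rightarrow> int \<Rightarrow> int \<Rightarrow> int \<Rightarrow> int"
  assumes M: "M > 0" and g: "g a b c d = 1"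
    and cong: "\<And>a' b' c' d'. \<lbrakk>[a' = a] (mod M); [b' = b] (mod M); [c' = c] (mod M); [d' = d] (mod M)\<rbrakk> \<Longrightarrow>
      [f a' b' c' d' = f a b c d] (mod M) \<and> [g a' b' c' d' = g a b c d] (mod M)"
    and residues: "\<forall>a\<in>set [0..M-1]. \<forall>b\<in>set [0..M-1]. \<forall>c\<in>set [0..M-1]. \<forall>d\<in>set [0..M-1].
      (g a b c d - 1) mod M = 0 \<longrightarrow> f a b c d mod M = 0"
  shows "M dvd f a b c d"
proof -
  define a' b' c' d' where "a' = a mod M" and "b' = b mod M" and "c' = c mod M" and "d' = d mod M"
  have m: "a' \<in> set [0..M-1]" "b' \<in> set [0..M-1]" "c' \<in> set [0..M-1]" "d' \<in> set [0..M-1]"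
    using M by (auto simp: a'_def b'_def c'_def d'_def)
  have cg: "[f a' b' c' d' = f a b c d] (mod M)" "[g a' b' c' d' = 1] (mod M)"
    using cong[of a' b' c' d'] g by (simp_all add: a'_def b'_def c'_def d'_def)
  from cg(2) have "(g a' b' c' d' - 1) mod M = 0"
    by (simp add: cong_iff_dvd_diff dvd_eq_mod_eq_0)
  with residues[rule_format, OF m] have "f a' b' c' d' mod M = 0" by simp
  with cg(1) show ?thesis by (simp add: cong_def dvd_eq_mod_eq_0)
qed

text \<open>The exponents belong to \<open>S A\<close> and \<open>A\<close>, with \<open>S\<close>
  the inversion; by \<open>dedekind_eta_S\<close> they must differ by -3, the exponent of the factor
  \<open>- \<i>\<close>. The claim is checked over all residues modulo 3 and modulo 4.\<close>

lemma eta2_exponent_S: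
  assumes det: "a * d - b * c = 1"
  shows "12 dvd eta2_exponent (- c) (- d) a b - eta2_exponent a b c d + 3"
proof -
  have *: "[eta2_exponent (- c') (- d') a' b' - eta2_exponent a' b' c' d' + 3 =
        eta2_exponent (- c) (- d) a b - eta2_exponent a b c d + 3] (mod M) \<and>
      [a' * d' - b' * c' = a * d - b * c] (mod M)"
    if "[a' = a] (mod M)" "[b' = b] (mod M)" "[c' = c] (mod M)" "[d' = d] (mod M)" for M a' b' c' d'
    using that
    by (intro conjI cong_diff cong_add eta2_exponent_cong cong_mult cong_refl) (simp_all add: cong_minus_minus_iff)
  have "3 dvd eta2_exponent (- c) (- d) a b - eta2_exponent a b c d + 3"
    by (rule dvd_by_residues[where g = "\<lambda>a b c d. a * d - b * c", OF _ det *], simp, assumption+, code_simp)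
  moreover have "4 dvd eta2_exponent (- c) (- d) a b - eta2_exponent a b c d + 3"
    by (rule dvd_by_residues[where g = "\<lambda>a b c d. a * d - b * c", OF _ det *], simp, assumption+, code_simp)
  ultimately show ?thesis by presburger
qed

text \<open>Translation by \<open>n\<close> changes the exponent by exactly
  \<open>n + n * (1 - c ^ 2) * (d ^ 2 - 1)\<close>, and the last term vanishes modulo 3 and modulo 4
  because \<open>c\<close> and \<open>d\<close> are coprime.\<close>

lemma eta2_exponent_T:
  assumes det: "a * d - b * c = 1"
  shows "12 dvd eta2_exponent (a + n * c) (b + n * d) c d - eta2_exponent a b c d - n"
proof -
  have *: "[(1 - c' ^ 2) * (d' ^ 2 - 1) = (1 - c ^ 2) * (d ^ 2 - 1)] (mod M) \<and>
      [a' * d' - b' * c' = a * d - b * c] (mod M)"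
    if "[a' = a] (mod M)" "[b' = b] (mod M)" "[c' = c] (mod M)" "[d' = d] (mod M)" for M a' b' c' d'
    using that by (intro conjI cong_diff cong_mult cong_pow cong_refl)
  have "3 dvd (1 - c ^ 2) * (d ^ 2 - 1)"
    by (rule dvd_by_residues[where g = "\<lambda>a b c d. a * d - b * c" and f = "\<lambda>a b c d. (1 - c ^ 2) * (d ^ 2 - 1)", OF _ det *],
        simp, assumption+, code_simp)
  moreover have "4 dvd (1 - c ^ 2) * (d ^ 2 - 1)"
    by (rule dvd_by_residues[where g = "\<lambda>a b c d. a * d - b * c" and f = "\<lambda>a b c d. (1 - c ^ 2) * (d ^ 2 - 1)", OF _ det *],
        simp, assumption+, code_simp)
  ultimately have "12 dvd (1 - c ^ 2) * (d ^ 2 - 1)" by presburger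
  moreover have "eta2_exponent (a + n * c) (b + n * d) c d - eta2_exponent a b c d - n = n * ((1 - c ^ 2) * (d ^ 2 - 1))"
    by (simp add: eta2_exponent_def algebra_simps power2_eq_square)
  ultimately show ?thesis by simp
qed

lemma epi_cong_12:
  assumes "12 dvd m - n"
  shows "epi (of_int m / 6) = epi (of_int n / 6)"
proof -
  obtain k where "m - n = 12 * k" using assms by (elim dvdE)
  then have "m = n + 12 * k" by simp
  then show ?thesis by (intro epi_eqI[of _ _ k]) (simp add: add_divide_distrib)
qed

text \<open>Euclid's algorithm on the first column: subtract \<open>a div c\<close> times the second
  row, then exchange the rows by the inversion, until \<open>c = 0\<close>. The multiplier of each
  step is known.\<close>

lemma dedekind_eta_squared_moebius:
  fixes a b c d :: int
  assumes "a * d - b * c = 1" "Im z > 0"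
  shows "dedekind_eta ((of_int a * z + of_int b) / (of_int c * z + of_int d)) ^ 2 =
    epi (of_int (eta2_exponent a b c d) / 6) * (of_int c * z + of_int d) * dedekind_eta z ^ 2"
  using assms(1)
proof (induction "nat \<bar>c\<bar>" arbitrary: a b c d rule: less_induct)
  case less
  note det = less.prems
  show ?case
  proof (cases "c = 0")
    case True
    then have "a * d = 1" using det by simp
    then consider "a = 1" "d = 1" | "a = -1" "d = -1"
      using zmult_eq_1_iff[of a d] by auto
    then show ?thesis
    proof cases
      case 1
      then show ?thesis using True dedekind_eta_add_int[of z b]
        by (simp add: eta2_exponent_def power_mult_distrib epi_power)
    next
      case 2
      \<comment> \<open>The matrix is minus a translation; the 6 in the exponent gives the sign that
        cancels against \<open>c * z + d = -1\<close>.\<close>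
      have "epi (of_int (6 - b) / 6) = - epi (- (of_int b / 6))"
        using epi_add[of 1 "- (of_int b / 6)"] by (simp add: diff_divide_distrib)
      moreover have "(- z + of_int b) / - 1 = z + of_int (- b)" by simp
      ultimately show ?thesis using True 2 dedekind_eta_add_int[of z "- b"]
        by (simp add: eta2_exponent_def power_mult_distrib epi_power)
    qed
  next
    case False
    define n a' b' where "n = a div c" and "a' = a - n * c" and "b' = b - n * d"
    have "a' = a mod c" by (simp add: a'_def n_def minus_div_mult_eq_mod)
    then have lt: "nat \<bar>- a'\<bar> < nat \<bar>c\<bar>"
      using False abs_mod_less[of c a] by simp
    have det': "c * - b' - d * - a' = 1" "a' * d - b' * c = 1"
      using det by (simp_all add: a'_def b'_def algebra_simps)
    define j w where "j = of_int c * z + of_int d" and "w = (of_int c * z + of_int d) / (of_int (- a') * z + of_int (- b'))"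
    have w: "Im w > 0" and j': "of_int (- a') * z + of_int (- b') \<noteq> 0"
      using moebius_Im_pos[OF det'(1) assms(2)] by (simp_all add: w_def)
    have j: "j \<noteq> 0" using moebius_Im_pos[OF det assms(2)] by (simp add: j_def)
    have IH: "dedekind_eta w ^ 2 = epi (of_int (eta2_exponent c d (- a') (- b')) / 6) * (of_int (- a') * z + of_int (- b')) * dedekind_eta z ^ 2"
      unfolding w_def by (rule less.hyps[OF lt det'(1)])
    \<comment> \<open>The original image arises from that of the smaller matrix by the inversion
      followed by translation by \<open>n\<close>.\<close>
    have "(of_int a * z + of_int b) / j = - 1 / w + of_int n"
      using j j' by (simp add: w_def j_def a'_def b'_def field_simps)
    then have "dedekind_eta ((of_int a * z + of_int b) / j) ^ 2 =
        epi (of_int n / 6) * (- \<i> * w * dedekind_eta w ^ 2)"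
      using dedekind_eta_S[OF w] by (simp only: dedekind_eta_add_int power_mult_distrib epi_power) simp
    also have "\<dots> = epi (of_int n / 6) * - \<i> * epi (of_int (eta2_exponent c d (- a') (- b')) / 6) * j * dedekind_eta z ^ 2"
      unfolding IH using j' by (simp add: w_def j_def)
    also have "- \<i> = epi (- 3 / 6)"
      by (simp add: epi_def exp_eq_polar complex_eq_iff cis.simps)
    also have "epi (of_int n / 6) * epi (- 3 / 6) * epi (of_int (eta2_exponent c d (- a') (- b')) / 6)
      = epi (of_int (n - 3 + eta2_exponent c d (- a') (- b')) / 6)"
      unfolding epi_add[symmetric] by (rule arg_cong[where f = epi]) (simp add: field_simps)
    also have "\<dots> = epi (of_int (eta2_exponent a b c d) / 6)"
    proof (rule epi_cong_12)
      have "12 dvd eta2_exponent a b c d - eta2_exponent a' b' c d - n"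
        using eta2_exponent_T[OF det'(2), of n] by (simp add: a'_def b'_def)
      moreover have "12 dvd eta2_exponent a' b' c d - eta2_exponent c d (- a') (- b') + 3"
        using eta2_exponent_S[OF det'(1)] by simp
      ultimately show "12 dvd n - 3 + eta2_exponent c d (- a') (- b') - eta2_exponent a b c d"
        by presburger
    qed
    finally show ?thesis by (simp add: j_def)
  qed
qed

text \<open>The two exponents belong to eta squared at \<open>z\<close> and at \<open>p * z\<close>
  under one element of \<open>\<Gamma>\<^sub>0(p)\<close>. Their sum enters the multiplier of an
  eta-quotient with the factor \<open>(p - 1) / 2\<close>. The proof works modulo 3 and modulo 8,
  where \<open>p - 1\<close> already supplies part of the divisor.\<close>

lemma eta2_exponent_level:
  fixes p :: int
  assumes det: "a * d - b * (p * c) = 1" and p: "\<not> 2 dvd p" "\<not> 3 dvd p"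
  shows "24 dvd (p - 1) * (eta2_exponent a b (p * c) d + eta2_exponent a (p * b) c d)"
proof -
  define F where "F = (\<lambda>p a b c d. eta2_exponent a b (p * c) d + eta2_exponent a (p * b) c d)"
  \<comment> \<open>Only the residue \<open>r\<close> of \<open>p\<close> matters, so each case is
    again a finite check.\<close>
  have *: "M dvd F p a b c d" if M: "M > 0" and r: "[r = p] (mod M)"
    and residues: "\<forall>a\<in>set [0..M-1]. \<forall>b\<in>set [0..M-1]. \<forall>c\<in>set [0..M-1]. \<forall>d\<in>set [0..M-1].
      (a * d - b * (r * c) - 1) mod M = 0 \<longrightarrow> F r a b c d mod M = 0" for M r
  proof -
    define f where "f = (\<lambda>a b c d. F p a b c d)"
    have fg: "[F r a b c d = F p a b c d] (mod M)" "[a * d - b * (r * c) = a * d - b * (p * c)] (mod M)" for a b c d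
      unfolding F_def using r by (intro cong_add cong_diff eta2_exponent_cong cong_mult cong_refl; simp)+
    have "M dvd f a b c d"
    proof (rule dvd_by_residues[where g = "\<lambda>a b c d. a * d - b * (p * c)", OF M det])
      show "[f a' b' c' d' = f a b c d] (mod M) \<and> [a' * d' - b' * (p * c') = a * d - b * (p * c)] (mod M)"
        if "[a' = a] (mod M)" "[b' = b] (mod M)" "[c' = c] (mod M)" "[d' = d] (mod M)" for a' b' c' d'
        unfolding f_def F_def using that
        by (intro conjI cong_add cong_diff eta2_exponent_cong cong_mult cong_refl)
      have "(a * d - b * (r * c) - 1) mod M = (a * d - b * (p * c) - 1) mod M" "F r a b c d mod M = f a b c d mod M" for a b c d
        using fg[of a b c d] cong_diff[OF fg(2) cong_refl[of 1]] by (simp_all add: f_def cong_def)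
      then show "\<forall>a\<in>set [0..M-1]. \<forall>b\<in>set [0..M-1]. \<forall>c\<in>set [0..M-1]. \<forall>d\<in>set [0..M-1].
        (a * d - b * (p * c) - 1) mod M = 0 \<longrightarrow> f a b c d mod M = 0"
        using residues by simp
    qed
    then show ?thesis by (simp add: f_def)
  qed
  have "3 dvd (p - 1) * F p a b c d"
  proof (cases "3 dvd p - 1")
    case False
    with p(2) have "p mod 3 = 2" by presburger
    then have r: "[2 = p] (mod 3)" by (simp add: cong_def)
    have "3 dvd F p a b c d" by (rule *[OF _ r]) (simp, unfold F_def, code_simp)
    then show ?thesis by simp
  qed simp
  moreover have "8 dvd (p - 1) * F p a b c d"
  proof (cases "4 dvd p - 1")
    case True
    have r: "[1 = p] (mod 2)" using p unfolding cong_def by presburger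
    have "2 dvd F p a b c d" by (rule *[OF _ r]) (simp, unfold F_def, code_simp)
    with True mult_dvd_mono[of 4 "p - 1" 2 "F p a b c d"] show ?thesis by simp
  next
    case False
    with p(1) have "p mod 4 = 3" by presburger
    then have r: "[3 = p] (mod 4)" by (simp add: cong_def)
    have "4 dvd F p a b c d" by (rule *[OF _ r]) (simp, unfold F_def, code_simp)
    moreover have "2 dvd p - 1" using p by presburger
    ultimately show ?thesis using mult_dvd_mono[of 2 "p - 1" 4 "F p a b c d"] by simp
  qed
  ultimately show ?thesis unfolding F_def by presburger
qed

section \<open>Division values of the Klein form\<close>

lemma sum_upto_double: "2 * (\<Sum>g=1..M. g) = M * (M + 1)" for M :: nat
  by (induction M) auto

lemma sum_squares_upto: "6 * (\<Sum>g=1..M. g ^ 2) = M * (M + 1) * (2 * M + 1)" for M :: nat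
  by (induction M) (auto simp: algebra_simps power2_eq_square)

text \<open>Up to a constant, the Klein form of the point \<open>g * z\<close> of order \<open>p\<close> modulo the lattice spanned by
  \<open>1\<close> and \<open>p * z\<close>; the exponential factor turns the Gaussian cocycle of \<open>klein\<close> into a root of unity.\<close>

definition klein_division :: "nat \<Rightarrow> nat \<Rightarrow> complex \<Rightarrow> complex" where
  "klein_division p g z = epi (of_nat g ^ 2 * z / of_nat p) * klein (of_nat g * z) (of_nat p * z)"

text \<open>\<open>qpoch_multisection\<close> splits the eta product at \<open>z\<close> into
  residue classes modulo \<open>p\<close>. The class of 0 is the product at \<open>p * z\<close>;
  the classes of \<open>g\<close> and \<open>p - g\<close> are the two products in
  \<open>klein_division p g\<close>.\<close>

lemma eta_ratio_klein_product:
  assumes z: "Im z > 0" and p: "p = 2 * M + 1"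
  shows "dedekind_eta z / dedekind_eta (of_nat p * z) =
    (\<Prod>g=1..M. klein_division p g z) * (dedekind_eta (of_nat p * z) ^ 2) ^ M"
proof -
  define q where "q = epi (2 * z)"
  have q: "norm q < 1" using norm_epi_less_1[OF z] by (simp add: q_def)
  have p0: "p > 0" using p by simp
  define P where "P = qpoch (q ^ p) (q ^ p)"
  have qp: "q ^ p = epi (2 * (of_nat p * z))" by (simp add: q_def epi_power mult_ac)
  have P0: "P \<noteq> 0" unfolding P_def using q p0
    by (intro qpoch_self_nonzero) (simp add: norm_power power_less_one_iff)
  define Q where "Q = (\<lambda>g. qpoch (q ^ g) (q ^ p))"
  have kd: "klein_division p g z = epi (of_nat (g ^ 2) * (z / of_nat p) + of_nat g * (- z)) * (Q g * Q (p - g)) / P ^ 2"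
    if "g \<in> {1..M}" for g
  proof -
    have "epi (2 * (of_nat g * z)) = q ^ g" by (simp add: q_def epi_power mult_ac)
    moreover have "epi (2 * (of_nat p * z) - 2 * (of_nat g * z)) = q ^ (p - g)"
      using that p by (simp add: q_def epi_power of_nat_diff algebra_simps)
    ultimately show ?thesis
      by (simp add: klein_division_def klein_def Q_def P_def qp[symmetric] epi_add epi_diff epi_minus divide_inverse mult.assoc)
  qed
  have "qpoch q q = (\<Prod>g<p. Q (Suc g))"
    using qpoch_multisection[OF q p0, of q] by (simp add: Q_def)
  also have "\<dots> = (\<Prod>g=1..p. Q g)"
    by (rule prod.reindex_bij_witness[of _ "\<lambda>g. g - 1" Suc]) auto
  also have "{1..p} = insert p ({1..M} \<union> {M+1..2*M})" using p by auto
  also have "prod Q \<dots> = P * (prod Q {1..M} * prod Q {M+1..2*M})"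
    using p by (subst prod.insert) (auto simp: P_def Q_def intro!: prod.union_disjoint)
  also have "prod Q {M+1..2*M} = (\<Prod>g=1..M. Q (p - g))"
    using p by (intro prod.reindex_bij_witness[of _ "\<lambda>g. p - g" "\<lambda>g. p - g"]) auto
  finally have qq: "qpoch q q = P * (\<Prod>g=1..M. Q g * Q (p - g))" by (simp add: prod.distrib)
  have "(\<Prod>g=1..M. klein_division p g z) =
    epi (\<Sum>g=1..M. of_nat (g ^ 2) * (z / of_nat p) + of_nat g * (- z)) * (\<Prod>g=1..M. Q g * Q (p - g)) / P ^ (2 * M)"
    by (simp add: kd prod_dividef prod.distrib epi_sum power_mult)
  also have "(\<Sum>g=1..M. of_nat (g ^ 2) * (z / of_nat p) + of_nat g * (- z)) =
      of_nat (\<Sum>g=1..M. g ^ 2) * (z / of_nat p) + of_nat (\<Sum>g=1..M. g) * (- z)"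
    unfolding sum.distrib sum_distrib_right[symmetric] of_nat_sum ..
  also have "of_nat (\<Sum>g=1..M. g ^ 2) = of_nat (M * (M + 1)) * of_nat p / (6 :: complex)"
  proof -
    have "of_nat (6 * (\<Sum>g=1..M. g ^ 2)) = (of_nat (M * (M + 1) * (2 * M + 1)) :: complex)"
      by (simp only: sum_squares_upto)
    then have "6 * of_nat (\<Sum>g=1..M. g ^ 2) = (of_nat (M * (M + 1)) * of_nat p :: complex)"
      by (simp only: of_nat_mult of_nat_numeral p)
    then show ?thesis by (simp add: mult.commute)
  qed
  also have "of_nat (\<Sum>g=1..M. g) = of_nat (M * (M + 1)) / (2 :: complex)"
  proof -
    have "of_nat (2 * (\<Sum>g=1..M. g)) = (of_nat (M * (M + 1)) :: complex)"
      by (simp only: sum_upto_double)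
    then show ?thesis by (simp add: mult.commute)
  qed
  \<comment> \<open>The exponents combine to the leading exponents of the eta values, so no stray
    power of \<open>q\<close> remains.\<close>
  also have "of_nat (M * (M + 1)) * of_nat p / 6 * (z / of_nat p) + of_nat (M * (M + 1)) / 2 * (- z)
      = z / 12 - of_nat p * z / 12 - of_nat M * (of_nat p * z / 6)"
  proof -
    have M: "of_nat M = (of_nat p - 1) / (2 :: complex)" using p by simp
    have "(of_nat p :: complex) \<noteq> 0" using p0 by simp
    then show ?thesis unfolding of_nat_mult of_nat_add of_nat_1 M by (simp add: field_simps)
  qed
  also have "(\<Prod>g=1..M. Q g * Q (p - g)) = qpoch q q / P" using qq P0 by simp
  finally have X: "(\<Prod>g=1..M. klein_division p g z) =
    epi (z / 12) / epi (of_nat p * z / 12) / epi (of_nat p * z / 6) ^ M * (qpoch q q / P) / P ^ (2 * M)"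
    by (simp add: epi_diff epi_power)
  have e2: "dedekind_eta (of_nat p * z) ^ 2 = epi (of_nat p * z / 6) * P ^ 2"
    unfolding dedekind_eta_eq qp[symmetric] P_def power_mult_distrib epi_power by (simp add: mult.commute)
  have e1: "dedekind_eta (of_nat p * z) = epi (of_nat p * z / 12) * P" "dedekind_eta z = epi (z / 12) * qpoch q q"
    by (simp_all add: dedekind_eta_eq qp[symmetric] P_def q_def)
  show ?thesis unfolding X e2 unfolding e1 power_mult_distrib power_mult[symmetric] using P0 by simp
qed

text \<open>On \<open>p * z\<close> the conjugate matrix \<open>(a, p * b; c, d)\<close> acts, and
  \<open>a = 1 + p * \<alpha>\<close> makes \<open>g * (a * z + b)\<close> differ from
  \<open>g * z\<close> by a lattice vector. So \<open>klein_moebius\<close> followed by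
  \<open>klein_add_lattice\<close> yields the factor.\<close>

lemma klein_division_moebius:
  fixes a b c d \<alpha> :: int
  assumes z: "Im z > 0" and p: "p > 0" and det: "a * d - b * (int p * c) = 1" and a: "a = 1 + int p * \<alpha>"
  defines "j \<equiv> of_int (int p * c) * z + of_int d"
  shows "klein_division p g ((of_int a * z + of_int b) / j) =
    inverse j * epi (of_nat g * of_int (\<alpha> + b) + of_nat (g ^ 2) * (of_int (a * b) / of_nat p)) * klein_division p g z"
proof -
  define P where "P = (of_nat p :: complex)"
  define \<gamma> where "\<gamma> = (of_int a * z + of_int b) / j"
  define u where "u = of_nat g * (of_int a * z + of_int b)"
  have P0: "P \<noteq> 0" using p by (simp add: P_def)
  have pz: "Im (P * z) > 0" using z p by (simp add: P_def)
  have j0: "j \<noteq> 0" using moebius_Im_pos[OF det z] by (simp add: j_def)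
  have det': "a * d - (int p * b) * c = 1" using det by (simp add: mult_ac)
  have detC: "of_int a * of_int d - of_int b * (P * of_int c) = (1::complex)"
    using arg_cong[OF det, of "of_int :: int \<Rightarrow> complex"] by (simp add: P_def)
  have aC: "of_int a = 1 + P * of_int \<alpha>" using a by (simp add: P_def)
  have "klein (of_nat g * \<gamma>) (P * \<gamma>) = klein (u / j) ((of_int a * (P * z) + of_int (int p * b)) / j)"
    by (rule arg_cong2[of _ _ _ _ klein]) (simp_all add: \<gamma>_def u_def P_def algebra_simps)
  also have "\<dots> = inverse j * epi (of_int c * u ^ 2 / j) * klein u (P * z)"
    using klein_moebius[OF det' pz, of u] by (simp add: j_def P_def mult_ac)
  also have "u = of_nat g * z + (of_int (int g * \<alpha>) * (P * z) + of_int (int g * b))"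
    unfolding u_def aC by (simp add: algebra_simps)
  then have "klein u (P * z) = epi (of_int (int g * \<alpha>) + of_int (int g * b) - of_int (int g * \<alpha>) ^ 2 * (P * z)
      - 2 * of_int (int g * \<alpha>) * (of_nat g * z)) * klein (of_nat g * z) (P * z)"
    by (simp only: klein_add_lattice[OF pz])
  finally have "klein_division p g \<gamma> = inverse j * epi (of_nat g ^ 2 * \<gamma> / P + of_int c * u ^ 2 / j +
      (of_int (int g * \<alpha>) + of_int (int g * b) - of_int (int g * \<alpha>) ^ 2 * (P * z)
      - 2 * of_int (int g * \<alpha>) * (of_nat g * z))) * klein (of_nat g * z) (P * z)"
    by (simp add: klein_division_def P_def epi_add)
  also have "of_nat g ^ 2 * \<gamma> / P + of_int c * u ^ 2 / j =
      of_nat g ^ 2 * ((of_int a * z + of_int b) * (1 + P * of_int c * (of_int a * z + of_int b)) / (P * j))"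
    using P0 j0 by (simp add: \<gamma>_def u_def power_mult_distrib field_simps power2_eq_square)
  \<comment> \<open>The determinant condition produces a factor \<open>j\<close> that cancels the
    denominator.\<close>
  also have "1 + P * of_int c * (of_int a * z + of_int b) = of_int a * j"
    unfolding detC[symmetric] j_def by (simp add: P_def algebra_simps)
  also have "(of_int a * z + of_int b) * (of_int a * j) / (P * j) = (of_int a * z + of_int b) * of_int a / P"
    using j0 by simp
  also have "of_nat g ^ 2 * ((of_int a * z + of_int b) * of_int a / P) +
      (of_int (int g * \<alpha>) + of_int (int g * b) - of_int (int g * \<alpha>) ^ 2 * (P * z)
      - 2 * of_int (int g * \<alpha>) * (of_nat g * z)) =
      (of_nat g * of_int (\<alpha> + b) + of_nat (g ^ 2) * (of_int (a * b) / P)) + of_nat g ^ 2 * z / P"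
    using P0 unfolding of_int_mult aC by (simp add: field_simps power2_eq_square)
  finally show ?thesis by (simp add: klein_division_def \<gamma>_def P_def epi_add)
qed

text \<open>Multiplying the roots of unity sums \<open>g\<close> and \<open>g ^ 2\<close>; with
  \<open>6 * n = M * (M + 1)\<close> these sums are \<open>3 * n\<close> and \<open>n * p\<close>,
  which removes the denominator \<open>p\<close>.\<close>

lemma klein_division_prod_moebius:
  fixes a b c d :: int
  assumes z: "Im z > 0" and p: "p = 2 * M + 1" and p3: "\<not> 3 dvd p"
    and det: "a * d - b * (int p * c) = 1" and a: "[a = 1] (mod int p)"
  defines "j \<equiv> of_int (int p * c) * z + of_int d"
  shows "(\<Prod>g=1..M. klein_division p g ((of_int a * z + of_int b) / j)) =
    inverse j ^ M * (\<Prod>g=1..M. klein_division p g z)"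
proof -
  obtain \<alpha> where \<alpha>: "a = 1 + int p * \<alpha>"
    using a by (metis cong_iff_lin cong_sym mult.commute)
  have p0: "p > 0" using p by simp
  have "6 dvd M * (M + 1)"
  proof -
    \<comment> \<open>As \<open>p = 2 * M + 1\<close>, the hypothesis \<open>p3\<close> excludes
      \<open>M \<equiv> 1\<close> modulo 3.\<close>
    have "3 dvd M \<or> 3 dvd M + 1" using p p3 by presburger
    then have "3 dvd M * (M + 1)" using dvd_mult dvd_mult2 by blast
    moreover have "2 dvd M * (M + 1)" by simp
    ultimately show ?thesis by presburger
  qed
  then obtain n where n: "M * (M + 1) = 6 * n" by (elim dvdE)
  have s1: "(\<Sum>g=1..M. g) = 3 * n" using sum_upto_double[of M] n by simp
  have s2: "(\<Sum>g=1..M. g ^ 2) = n * p" using sum_squares_upto[of M] n p by simp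
  txt \<open>The exponents add up to an even integer because \<open>a\<close> and \<open>b\<close> cannot both be even.\<close>
  have "odd (int p)" using p by simp
  then have "even (3 * (\<alpha> + b) + a * b)"
    using arg_cong[OF det, of even] by (simp add: \<alpha>; blast)
  then obtain l where l: "3 * (\<alpha> + b) + a * b = 2 * l" by (elim evenE)
  have "(\<Sum>g=1..M. of_nat g * of_int (\<alpha> + b) + of_nat (g ^ 2) * (of_int (a * b) / of_nat p)) =
      of_nat (3 * n) * of_int (\<alpha> + b) + of_nat (n * p) * (of_int (a * b) / of_nat p :: complex)"
    unfolding sum.distrib sum_distrib_right[symmetric] of_nat_sum[symmetric] s1 s2 ..
  also have "\<dots> = of_nat n * of_int (3 * (\<alpha> + b) + a * b)"
    using p0 by (simp add: field_simps)
  also have "\<dots> = 2 * of_int (int n * l)" unfolding l by simp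
  finally have e: "(\<Prod>g=1..M. epi (of_nat g * of_int (\<alpha> + b) + of_nat (g ^ 2) * (of_int (a * b) / of_nat p))) = 1"
    by (simp only: epi_sum[symmetric] finite_atLeastAtMost epi_even)
  show ?thesis
    unfolding j_def klein_division_moebius[OF z p0 det \<alpha>] prod.distrib e by simp
qed

text \<open>The weights cancel: \<open>inverse j ^ M\<close> from the Klein values against
  \<open>j ^ M\<close> from the \<open>M\<close>-th power of eta squared at \<open>p * z\<close>.
  Only the root of unity of the latter survives, without any sign ambiguity.\<close>

lemma eta_ratio_moebius:
  fixes a b c d :: int
  assumes z: "Im z > 0" and p: "p = 2 * M + 1" and p3: "\<not> 3 dvd p"
    and det: "a * d - b * (int p * c) = 1" and a: "[a = 1] (mod int p)"
  defines "\<gamma> \<equiv> (of_int a * z + of_int b) / (of_int (int p * c) * z + of_int d)"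
  shows "dedekind_eta \<gamma> / dedekind_eta (of_nat p * \<gamma>) =
    epi (of_int (int M * eta2_exponent a (int p * b) c d) / 6) * (dedekind_eta z / dedekind_eta (of_nat p * z))"
proof -
  define j where "j = of_int (int p * c) * z + of_int d"
  have j0: "j \<noteq> 0" and \<gamma>: "Im \<gamma> > 0" using moebius_Im_pos[OF det z] by (simp_all add: j_def \<gamma>_def)
  have det': "a * d - (int p * b) * c = 1" using det by (simp add: mult_ac)
  have pz: "Im (of_nat p * z) > 0" using z p by simp
  have "of_nat p * \<gamma> = (of_int a * (of_nat p * z) + of_int (int p * b)) / (of_int c * (of_nat p * z) + of_int d)"
    by (simp add: \<gamma>_def algebra_simps)
  then have e: "dedekind_eta (of_nat p * \<gamma>) ^ 2 =
      epi (of_int (eta2_exponent a (int p * b) c d) / 6) * j * dedekind_eta (of_nat p * z) ^ 2"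
    using dedekind_eta_squared_moebius[OF det' pz] by (simp add: j_def mult_ac)
  show ?thesis
    unfolding eta_ratio_klein_product[OF \<gamma> p] eta_ratio_klein_product[OF z p] e
    unfolding \<gamma>_def klein_division_prod_moebius[OF z p p3 det a] power_mult_distrib epi_power
    using j0 by (simp add: j_def field_simps)
qed

text \<open>Since \<open>r1 + rp = 2 * k\<close>, the eta-quotient is the \<open>k\<close>-th power
  of eta squared times the ratio of \<open>eta_ratio_moebius\<close> to the power
  \<open>- rp\<close>, and both multipliers are explicit.\<close>

lemma eta_quotient_moebius:
  fixes a b c d r1 rp s k :: int
  assumes z: "Im z > 0" and p: "odd p" and p3: "\<not> 3 dvd p"
    and det: "a * d - b * (int p * c) = 1" and a: "[a = 1] (mod int p)"
    and r: "r1 + rp = 2 * k" "r1 + int p * rp = 24 * s"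
  defines "j \<equiv> of_int (int p * c) * z + of_int d"
  defines "\<gamma> \<equiv> (of_int a * z + of_int b) / j"
  shows "dedekind_eta \<gamma> powi r1 * dedekind_eta (of_nat p * \<gamma>) powi rp =
    j powi k * (dedekind_eta z powi r1 * dedekind_eta (of_nat p * z) powi rp)"
proof -
  obtain M where M: "p = 2 * M + 1" using p by (elim oddE)
  define F1 F2 where "F1 = eta2_exponent a b (int p * c) d" and "F2 = eta2_exponent a (int p * b) c d"
  have \<gamma>: "Im \<gamma> > 0" using moebius_Im_pos[OF det z] by (simp add: j_def \<gamma>_def)
  have pz: "Im (of_nat p * z) > 0" "Im (of_nat p * \<gamma>) > 0" using z \<gamma> M by simp_all
  have split: "x powi r1 * y powi rp = (x ^ 2) powi k * (x / y) powi (- rp)" if "x \<noteq> 0" "y \<noteq> 0" for x y :: complex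
  proof -
    have "(x ^ 2) powi k = x powi (r1 + rp)" unfolding r(1) by (simp add: power_int_mult)
    then show ?thesis using that
      by (simp add: power_int_add power_int_divide_distrib power_int_minus field_simps)
  qed
  have "24 dvd (int p - 1) * (F1 + F2)"
    unfolding F1_def F2_def using eta2_exponent_level[OF det] p p3
    by (metis even_of_nat int_dvd_int_iff of_nat_numeral)
  then have "12 dvd int M * (F1 + F2)" using M by (simp add: mult.assoc, presburger)
  then obtain l where l: "int M * (F1 + F2) = 12 * l" by (elim dvdE)
  \<comment> \<open>Eliminating \<open>r1\<close> expresses the total exponent through
    \<open>12 * s\<close> and \<open>M * (F1 + F2)\<close>, both multiples of 12.\<close>
  have keq: "k = 12 * s - int M * rp" using r M by (simp add: algebra_simps)
  have "k * F1 - rp * (int M * F2) = 12 * s * F1 - rp * (int M * (F1 + F2))"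
    unfolding keq by (simp add: algebra_simps)
  then have kF: "k * F1 - rp * (int M * F2) = 12 * (s * F1 - rp * l)"
    unfolding l by (simp add: algebra_simps)
  have "dedekind_eta \<gamma> powi r1 * dedekind_eta (of_nat p * \<gamma>) powi rp =
      (dedekind_eta \<gamma> ^ 2) powi k * (dedekind_eta \<gamma> / dedekind_eta (of_nat p * \<gamma>)) powi (- rp)"
    by (intro split dedekind_eta_nonzero \<gamma> pz)
  also have "dedekind_eta \<gamma> ^ 2 = epi (of_int F1 / 6) * j * dedekind_eta z ^ 2"
    using dedekind_eta_squared_moebius[OF det z] by (simp add: \<gamma>_def j_def F1_def)
  also have "dedekind_eta \<gamma> / dedekind_eta (of_nat p * \<gamma>) =
      epi (of_int (int M * F2) / 6) * (dedekind_eta z / dedekind_eta (of_nat p * z))"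
    using eta_ratio_moebius[OF z M p3 det a] by (simp add: \<gamma>_def j_def F2_def)
  also have "(epi (of_int F1 / 6) * j * dedekind_eta z ^ 2) powi k *
      (epi (of_int (int M * F2) / 6) * (dedekind_eta z / dedekind_eta (of_nat p * z))) powi (- rp) =
      (epi (of_int F1 / 6) powi k * epi (of_int (int M * F2) / 6) powi (- rp)) * j powi k *
      ((dedekind_eta z ^ 2) powi k * (dedekind_eta z / dedekind_eta (of_nat p * z)) powi (- rp))"
    by (simp only: power_int_mult_distrib mult_ac)
  also have "epi (of_int F1 / 6) powi k * epi (of_int (int M * F2) / 6) powi (- rp) =
      epi (of_int (k * F1 - rp * (int M * F2)) / 6)"
    unfolding epi_power_int epi_add[symmetric] by (rule arg_cong[where f = epi]) (simp add: field_simps)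
  also have "\<dots> = epi (2 * of_int (s * F1 - rp * l))" unfolding kF by (rule arg_cong[where f = epi]) simp
  also have "(dedekind_eta z ^ 2) powi k * (dedekind_eta z / dedekind_eta (of_nat p * z)) powi (- rp) =
      dedekind_eta z powi r1 * dedekind_eta (of_nat p * z) powi rp"
    by (intro split[symmetric] dedekind_eta_nonzero z pz)
  finally show ?thesis by (simp only: epi_even mult_1)
qed

section \<open>Eta-quotients as cusp forms\<close>

text \<open>Absolute values discard the multiplier, so growth at the cusps can be studied under all
  of \<open>SL2Z\<close> without choosing a branch of the square root.\<close>

lemma norm_dedekind_eta_moebius:
  fixes a b c d :: int
  assumes "a * d - b * c = 1" "Im z > 0"
  shows "norm (dedekind_eta ((of_int a * z + of_int b) / (of_int c * z + of_int d))) =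
    norm (of_int c * z + of_int d) powr (1 / 2) * norm (dedekind_eta z)"
proof (rule power2_eq_imp_eq)
  show "norm (dedekind_eta ((of_int a * z + of_int b) / (of_int c * z + of_int d))) ^ 2 =
    (norm (of_int c * z + of_int d) powr (1 / 2) * norm (dedekind_eta z)) ^ 2"
    using arg_cong[OF dedekind_eta_squared_moebius[OF assms], of norm]
    by (simp add: norm_mult norm_power norm_epi power_mult_distrib powr_half_sqrt)
qed auto

lemma sqrt_power_int:
  fixes x :: real
  assumes "x > 0"
  shows "(x powr (1 / 2)) powi n = x powr (of_int n / 2)"
proof -
  have "(x powr (1 / 2)) powi n = (x powr (1 / 2)) powr of_int n"
    using assms by (subst powr_real_of_int') auto
  then show ?thesis by (simp add: powr_powr)
qed

section \<open>Growth of eta products at infinity\<close>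

lemma filtercomap_Im_at_top_neq_bot: "filtercomap Im at_top \<noteq> bot"
  by (rule filtercomap_neq_bot_surj) (auto simp: surj_def intro: complex.sel(2)[symmetric])

lemma eventually_Im_pos: "eventually (\<lambda>z. Im z > 0) (filtercomap Im at_top)"
  by (rule eventually_filtercomapI[OF eventually_gt_at_top])

text \<open>Allowing any \<open>g\<close> that scales the imaginary part covers both cusps:
  \<open>g z\<close> is \<open>p * z\<close> at infinity and \<open>(z + l) / p\<close> at
  0.\<close>

lemma eta_product_asymp:
  fixes g :: "complex \<Rightarrow> complex"
  assumes \<kappa>: "\<kappa> > 0" and g: "\<And>z. Im (g z) = \<kappa> * Im z"
  shows "((\<lambda>z. norm (dedekind_eta z powi r * dedekind_eta (g z) powi s) *
    exp (pi / 12 * (of_int r + \<kappa> * of_int s) * Im z)) \<longlongrightarrow> 1) (filtercomap Im at_top)"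
proof -
  have 1: "filterlim Im at_top (filtercomap Im at_top)" by (rule filterlim_filtercomap)
  then have 2: "filterlim (\<lambda>z. Im (g z)) at_top (filtercomap Im at_top)"
    unfolding g using filterlim_tendsto_pos_mult_at_top[OF tendsto_const \<kappa>] by blast
  have "((\<lambda>z. norm ((dedekind_eta z / epi (z / 12)) powi r * (dedekind_eta (g z) / epi (g z / 12)) powi s))
      \<longlongrightarrow> norm (1 powi r * 1 powi s :: complex)) (filtercomap Im at_top)"
    by (intro tendsto_norm tendsto_mult tendsto_power_int dedekind_eta_asymp 1[unfolded id_def] 2) auto
  moreover have "norm ((dedekind_eta z / epi (z / 12)) powi r * (dedekind_eta (g z) / epi (g z / 12)) powi s) =
      norm (dedekind_eta z powi r * dedekind_eta (g z) powi s) * exp (pi / 12 * (of_int r + \<kappa> * of_int s) * Im z)" for z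
  proof -
    have e: "norm (epi w) powi n = exp (- (pi * Im w) * of_int n)" for w n
      by (simp add: norm_epi exp_power_int mult_ac)
    have "norm (epi (z / 12)) powi r * norm (epi (g z / 12)) powi s = exp (- (pi / 12 * (of_int r + \<kappa> * of_int s) * Im z))"
      unfolding e exp_add[symmetric] by (rule arg_cong[where f = exp]) (simp add: g field_simps)
    then show ?thesis
      by (simp add: norm_mult norm_power_int norm_divide power_int_divide_distrib exp_minus field_simps)
  qed
  ultimately show ?thesis by simp
qed

lemma eta_product_tendsto_0_iff:
  fixes g :: "complex \<Rightarrow> complex"
  assumes \<kappa>: "\<kappa> > 0" and g: "\<And>z. Im (g z) = \<kappa> * Im z"
  shows "((\<lambda>z. norm (dedekind_eta z powi r * dedekind_eta (g z) powi s)) \<longlongrightarrow> 0) (filtercomap Im at_top) \<longleftrightarrow>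
    of_int r + \<kappa> * of_int s > 0" (is "?L \<longleftrightarrow> ?e > 0")
proof
  let ?F = "filtercomap Im at_top"
  let ?h = "\<lambda>z. norm (dedekind_eta z powi r * dedekind_eta (g z) powi s)"
  note asymp = eta_product_asymp[OF assms, of r s]
  show "?e > 0" if ?L
  proof (rule ccontr)
    assume "\<not> ?e > 0"
    \<comment> \<open>For a non-positive exponent the exponential is at most 1, so a norm tending to
      0 would force the normalised norm to 0, against its limit 1.\<close>
    then have "pi / 12 * ?e * Im z \<le> 0" if "Im z > 0" for z
      using that by (simp add: mult_nonpos_nonneg mult_nonneg_nonpos)
    then have "norm (?h z * exp (pi / 12 * ?e * Im z)) \<le> ?h z" if "Im z > 0" for z
      using that mult_left_mono[of "exp (pi / 12 * ?e * Im z)" 1 "?h z"] by (simp add: abs_mult)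
    then have "eventually (\<lambda>z. norm (?h z * exp (pi / 12 * ?e * Im z)) \<le> ?h z) ?F"
      by (rule eventually_mono[OF eventually_Im_pos])
    then have "((\<lambda>z. ?h z * exp (pi / 12 * ?e * Im z)) \<longlongrightarrow> 0) ?F"
      using that by (rule Lim_null_comparison)
    with asymp show False
      using tendsto_unique[OF filtercomap_Im_at_top_neq_bot] by fastforce
  qed
  show ?L if "?e > 0"
  proof -
    have "((\<lambda>y::real. exp (- (pi / 12 * ?e * y))) \<longlongrightarrow> 0) at_top" using that by real_asymp
    then have "((\<lambda>z. exp (- (pi / 12 * ?e * Im z))) \<longlongrightarrow> 0) ?F"
      by (rule filterlim_compose) (rule filterlim_filtercomap)
    from tendsto_mult[OF asymp this] show ?L
      by (simp add: exp_minus field_simps)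
  qed
qed

lemma eta_quotient_apply:
  "Im z > 0 \<Longrightarrow> eta_quotient p r1 rp z = dedekind_eta z powi r1 * dedekind_eta (of_nat p * z) powi rp"
  by (simp add: eta_quotient_def upper_half_plane_def)

lemma eta_quotient_nonzero:
  assumes "Im z > 0" "p > 0"
  shows "eta_quotient p r1 rp z \<noteq> 0"
  using assms dedekind_eta_nonzero[of z] dedekind_eta_nonzero[of "of_nat p * z"]
  by (simp add: eta_quotient_apply power_int_eq_0_iff)

lemma eta_quotient_holomorphic:
  assumes "p > 0"
  shows "eta_quotient p r1 rp holomorphic_on upper_half_plane"
proof -
  have "(dedekind_eta \<circ> (\<lambda>z. of_nat p * z)) holomorphic_on upper_half_plane"
    using assms by (intro holomorphic_on_compose_gen[OF _ dedekind_eta_holomorphic])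
      (auto intro!: holomorphic_intros simp: upper_half_plane_def)
  then have "(\<lambda>z. dedekind_eta z powi r1 * dedekind_eta (of_nat p * z) powi rp) holomorphic_on upper_half_plane"
    using assms
    by (intro holomorphic_intros dedekind_eta_holomorphic) (auto simp: upper_half_plane_def dedekind_eta_nonzero o_def)
  then show ?thesis
    by (rule holomorphic_transform) (simp add: eta_quotient_def)
qed

lemma norm_eta_quotient_Gamma0:
  fixes a b c d r1 rp k :: int
  assumes z: "Im z > 0" and det: "a * d - b * (int p * c) = 1" and p: "p > 0"
  defines "j \<equiv> of_int (int p * c) * z + of_int d"
  shows "norm (eta_quotient p r1 rp ((of_int a * z + of_int b) / j)) =
    norm j powr (of_int (r1 + rp) / 2) * norm (dedekind_eta z powi r1 * dedekind_eta (of_nat p * z) powi rp)"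
proof -
  define \<gamma> where "\<gamma> = (of_int a * z + of_int b) / j"
  have j0: "j \<noteq> 0" and \<gamma>: "Im \<gamma> > 0" using moebius_Im_pos[OF det z] by (simp_all add: j_def \<gamma>_def)
  have det': "a * d - (int p * b) * c = 1" using det by (simp add: mult_ac)
  have pz: "Im (of_nat p * z) > 0" using z p by simp
  have "of_nat p * \<gamma> = (of_int a * (of_nat p * z) + of_int (int p * b)) / (of_int c * (of_nat p * z) + of_int d)"
    by (simp add: \<gamma>_def j_def algebra_simps)
  then have e: "norm (dedekind_eta (of_nat p * \<gamma>)) = norm j powr (1 / 2) * norm (dedekind_eta (of_nat p * z))"
    using norm_dedekind_eta_moebius[OF det' pz] by (simp add: j_def mult_ac)
  have e': "norm (dedekind_eta \<gamma>) = norm j powr (1 / 2) * norm (dedekind_eta z)"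
    using norm_dedekind_eta_moebius[OF det z] by (simp add: j_def \<gamma>_def)
  have "norm j powr (of_int (r1 + rp) / 2) = (norm j powr (1 / 2)) powi r1 * (norm j powr (1 / 2)) powi rp"
    using j0 by (simp add: sqrt_power_int powr_add[symmetric] add_divide_distrib)
  then show ?thesis
    unfolding \<gamma>_def[symmetric] eta_quotient_apply[OF \<gamma>] norm_mult norm_power_int e e' power_int_mult_distrib
    by simp
qed

text \<open>The matrix \<open>(p * a, p * b; c, d)\<close> of determinant \<open>p\<close> factors as an element of \<open>SL2Z\<close> times
  \<open>(1, l; 0, p)\<close>, where \<open>c * l \<equiv> d\<close> modulo \<open>p\<close>.\<close>

lemma norm_eta_quotient_moebius_coprime:
  fixes a b c d r1 rp :: int
  assumes det: "a * d - b * c = 1" and p: "p > 0" and cp: "coprime c (int p)"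
  shows "\<exists>l::int. \<forall>z. Im z > 0 \<longrightarrow>
    norm (eta_quotient p r1 rp ((of_int a * z + of_int b) / (of_int c * z + of_int d))) =
    real p powr (- of_int rp / 2) * norm (of_int c * z + of_int d) powr (of_int (r1 + rp) / 2) *
      norm (dedekind_eta z powi r1 * dedekind_eta ((z + of_int l) / of_nat p) powi rp)"
proof -
  obtain l w where lw: "c * l + int p * w = d"
  proof -
    obtain x y where "x * c + y * int p = 1" using cp by (metis bezout_int coprime_iff_gcd_eq_1)
    then have "d * (x * c + y * int p) = d" by simp
    then have "c * (d * x) + int p * (d * y) = d" by (simp add: algebra_simps)
    then show ?thesis using that by blast
  qed
  \<comment> \<open>\<open>y\<close> and \<open>w\<close> complete the factor
    \<open>(p * a, y; c, w)\<close> in \<open>SL2Z\<close>.\<close>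
  define y where "y = b - a * l"
  have "int p * a * w - y * c = a * (c * l + int p * w) - b * c" by (simp add: y_def algebra_simps)
  then have det': "int p * a * w - y * c = 1" using lw det by simp
  show ?thesis
  proof (intro exI[of _ l] allI impI)
    fix z :: complex assume z: "Im z > 0"
    define j where "j = of_int c * z + of_int d"
    define \<gamma> where "\<gamma> = (of_int a * z + of_int b) / j"
    define z' where "z' = (z + of_int l) / of_nat p"
    have P0: "(of_nat p :: complex) \<noteq> 0" using p by simp
    have j0: "j \<noteq> 0" and \<gamma>: "Im \<gamma> > 0" using moebius_Im_pos[OF det z] by (simp_all add: j_def \<gamma>_def)
    have z': "Im z' > 0" using z p by (simp add: z'_def)
    have pz': "of_nat p * z' = z + of_int l" using P0 by (simp add: z'_def)
    have "of_nat p * (of_int c * z' + of_int w) = of_int c * (of_nat p * z') + of_nat p * of_int w"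
      by (simp add: algebra_simps)
    also have "\<dots> = of_int c * z + of_int (c * l + int p * w)" unfolding pz' by (simp add: algebra_simps)
    finally have jw: "of_int c * z' + of_int w = j / of_nat p"
      using P0 unfolding lw j_def by (simp add: field_simps)
    have "of_int (int p * a) * z' + of_int y = of_int a * (of_nat p * z') + of_int (b - a * l)"
      by (simp add: y_def algebra_simps)
    also have "\<dots> = of_int a * z + of_int b" unfolding pz' by (simp add: algebra_simps)
    finally have "(of_int (int p * a) * z' + of_int y) / (of_int c * z' + of_int w) = of_nat p * \<gamma>"
      using P0 j0 unfolding jw by (simp add: \<gamma>_def)
    then have e: "norm (dedekind_eta (of_nat p * \<gamma>)) = (norm j / real p) powr (1 / 2) * norm (dedekind_eta z')"
      using norm_dedekind_eta_moebius[OF det' z'] unfolding jw by (simp add: norm_divide)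
    have e': "norm (dedekind_eta \<gamma>) = norm j powr (1 / 2) * norm (dedekind_eta z)"
      using norm_dedekind_eta_moebius[OF det z] by (simp add: j_def \<gamma>_def)
    have jp: "norm j > 0" "norm j / real p > 0" using j0 p by simp_all
    have "real p powr (- of_int rp / 2) = inverse (real p powr (of_int rp / 2))"
      by (simp only: minus_divide_left[symmetric] powr_minus)
    moreover have "norm j powr (of_int (r1 + rp) / 2) = norm j powr (of_int r1 / 2) * norm j powr (of_int rp / 2)"
      by (simp only: of_int_add add_divide_distrib powr_add)
    moreover have "(norm j / real p) powr (of_int rp / 2) = norm j powr (of_int rp / 2) * inverse (real p powr (of_int rp / 2))"
      by (simp only: powr_divide) (simp only: divide_inverse)
    ultimately have "real p powr (- of_int rp / 2) * norm j powr (of_int (r1 + rp) / 2) =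
        (norm j powr (1 / 2)) powi r1 * ((norm j / real p) powr (1 / 2)) powi rp"
      unfolding jp[THEN sqrt_power_int] by (simp only: mult_ac)
    then show "norm (eta_quotient p r1 rp ((of_int a * z + of_int b) / (of_int c * z + of_int d))) =
      real p powr (- of_int rp / 2) * norm (of_int c * z + of_int d) powr (of_int (r1 + rp) / 2) *
      norm (dedekind_eta z powi r1 * dedekind_eta ((z + of_int l) / of_nat p) powi rp)"
      unfolding j_def[symmetric] \<gamma>_def[symmetric] z'_def[symmetric] eta_quotient_apply[OF \<gamma>] norm_mult
        norm_power_int e e' power_int_mult_distrib
      by simp
  qed
qed

section \<open>Vanishing at the two cusps and the criterion for cusp forms\<close>

definition mat2 :: "int \<Rightarrow> int \<Rightarrow> int \<Rightarrow> int \<Rightarrow> int ^ 2 ^ 2" where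
  "mat2 a b c d = vector [vector [a, b], vector [c, d]]"

lemma mat2_nth [simp]:
  "mat2 a b c d $ 1 $ 1 = a" "mat2 a b c d $ 1 $ 2 = b"
  "mat2 a b c d $ 2 $ 1 = c" "mat2 a b c d $ 2 $ 2 = d"
  by (simp_all add: mat2_def vector_2)

lemma SL2Z_iff: "A \<in> SL2Z \<longleftrightarrow> A $ 1 $ 1 * A $ 2 $ 2 - A $ 1 $ 2 * A $ 2 $ 1 = 1"
  by (simp add: SL2Z_def det_2)

text \<open>The cusp \<open>a / c\<close> is equivalent to infinity under
  \<open>\<Gamma>\<^sub>0(p)\<close> if \<open>p\<close> divides \<open>c\<close>, and to 0
  otherwise. Because \<open>r1 + rp = 2 * k\<close>, the automorphy factors cancel in absolute value
  and leave an eta product of known growth.\<close>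

lemma slash_eta_quotient_tendsto_0:
  assumes A: "A \<in> SL2Z" and p: "prime p" and r: "r1 + rp = 2 * k"
  shows "((slash k A (eta_quotient p r1 rp)) \<longlongrightarrow> 0) (filtercomap Im at_top) \<longleftrightarrow>
    (if int p dvd A $ 2 $ 1 then r1 + int p * rp > 0 else int p * r1 + rp > 0)"
proof -
  let ?F = "filtercomap Im at_top"
  define a b c d where "a = A $ 1 $ 1" and "b = A $ 1 $ 2" and "c = A $ 2 $ 1" and "d = A $ 2 $ 2"
  have det: "a * d - b * c = 1" using A by (simp add: SL2Z_iff a_def b_def c_def d_def)
  have p0: "p > 0" using p by (simp add: prime_gt_0_nat)
  have slash: "norm (slash k A f z) = norm (of_int c * z + of_int d) powr - of_int k *
      norm (f ((of_int a * z + of_int b) / (of_int c * z + of_int d)))" if "Im z > 0" for f z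
  proof -
    have "norm (of_int c * z + of_int d) powi - k = norm (of_int c * z + of_int d) powr of_int (- k)"
      using moebius_Im_pos(1)[OF det that] by (subst powr_real_of_int') auto
    then show ?thesis
      by (simp add: slash_def norm_mult norm_power_int a_def b_def c_def d_def)
  qed
  have cancel: "norm (of_int c * z + of_int d) powr - of_int k * norm (of_int c * z + of_int d) powr (of_int (r1 + rp) / 2) = 1"
    if "Im z > 0" for z
    using moebius_Im_pos(1)[OF det that] by (simp add: r powr_add[symmetric])
  have lim: "(slash k A (eta_quotient p r1 rp) \<longlongrightarrow> 0) ?F \<longleftrightarrow> of_int r1 + \<kappa> * of_int rp > 0"
    if C: "C > 0" and \<kappa>: "\<kappa> > 0" "\<And>z. Im (g z) = \<kappa> * Im z" and
      eq: "\<And>z. Im z > 0 \<Longrightarrow> norm (eta_quotient p r1 rp ((of_int a * z + of_int b) / (of_int c * z + of_int d))) =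
        C * norm (of_int c * z + of_int d) powr (of_int (r1 + rp) / 2) *
        norm (dedekind_eta z powi r1 * dedekind_eta (g z) powi rp)" for C \<kappa> :: real and g
  proof -
    let ?h = "\<lambda>z. norm (dedekind_eta z powi r1 * dedekind_eta (g z) powi rp)"
    have "norm (slash k A (eta_quotient p r1 rp) z) = C * ?h z" if "Im z > 0" for z
      unfolding slash[OF that] eq[OF that] using cancel[OF that] by (simp add: algebra_simps)
    then have ev: "eventually (\<lambda>z. norm (slash k A (eta_quotient p r1 rp) z) = C * ?h z) ?F"
      by (rule eventually_mono[OF eventually_Im_pos])
    have "(slash k A (eta_quotient p r1 rp) \<longlongrightarrow> 0) ?F \<longleftrightarrow> ((\<lambda>z. C * ?h z) \<longlongrightarrow> 0) ?F"
      unfolding tendsto_norm_zero_iff[symmetric, of "slash k A (eta_quotient p r1 rp)"] by (rule tendsto_cong[OF ev])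
    also have "\<dots> \<longleftrightarrow> (?h \<longlongrightarrow> 0) ?F"
      using tendsto_mult_left_iff[of C ?h 0 ?F] C by simp
    finally show ?thesis using eta_product_tendsto_0_iff[OF \<kappa>] by simp
  qed
  show ?thesis
  proof (cases "int p dvd c")
    case True
    then obtain c' where c': "c = int p * c'" by (elim dvdE)
    have "(slash k A (eta_quotient p r1 rp) \<longlongrightarrow> 0) ?F \<longleftrightarrow> of_int r1 + real p * of_int rp > 0"
      using norm_eta_quotient_Gamma0[OF _ det[unfolded c'] p0] p0
      by (intro lim[where C = 1 and g = "\<lambda>z. of_nat p * z"]) (auto simp: c')
    also have "of_int r1 + real p * of_int rp = real_of_int (r1 + int p * rp)" by simp
    finally show ?thesis using True by (simp only: c_def of_int_0_less_iff if_True)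
  next
    case False
    then have cp: "coprime c (int p)"
      using p by (metis coprime_commute prime_imp_coprime prime_nat_int_transfer)
    obtain l :: int where l: "\<And>z. Im z > 0 \<Longrightarrow>
      norm (eta_quotient p r1 rp ((of_int a * z + of_int b) / (of_int c * z + of_int d))) =
      real p powr (- of_int rp / 2) * norm (of_int c * z + of_int d) powr (of_int (r1 + rp) / 2) *
      norm (dedekind_eta z powi r1 * dedekind_eta ((z + of_int l) / of_nat p) powi rp)"
      using norm_eta_quotient_moebius_coprime[OF det p0 cp, of r1 rp] by blast
    have "(slash k A (eta_quotient p r1 rp) \<longlongrightarrow> 0) ?F \<longleftrightarrow> of_int r1 + 1 / real p * of_int rp > 0"
      using p0 by (intro lim[OF _ _ _ l]) auto
    also have "\<dots> \<longleftrightarrow> real_of_int (int p * r1 + rp) > 0"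
      using p0 by (simp add: field_simps)
    finally show ?thesis using False by (simp only: c_def of_int_0_less_iff if_False)
  qed
qed

text \<open>Necessity tests single matrices: \<open>(1, 0; p, 1)\<close> gives the weight,
  translation by 1 the divisibility by 24, the identity and the inversion the two positivity
  conditions. Sufficiency rests on \<open>eta_quotient_moebius\<close>.\<close>

lemma eta_quotient_cusp_form_iff:
  assumes p: "prime p" "p > 3"
  shows "eta_quotient p r1 rp \<in> cusp_forms k (Gamma1 p) \<longleftrightarrow>
    r1 + rp = 2 * k \<and> 24 dvd r1 + int p * rp \<and> r1 + int p * rp > 0 \<and> int p * r1 + rp > 0"
    (is "?L \<longleftrightarrow> ?R")
proof
  let ?f = "eta_quotient p r1 rp"
  have p0: "p > 0" using p by simp
  {
    assume ?L
    then have inv: "\<And>A z. A \<in> Gamma1 p \<Longrightarrow> Im z > 0 \<Longrightarrow> slash k A ?f z = ?f z"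
      and van: "\<And>A. A \<in> SL2Z \<Longrightarrow> (slash k A ?f \<longlongrightarrow> 0) (filtercomap Im at_top)"
      by (auto simp: cusp_forms_def vanishes_at_cusps_def upper_half_plane_def)
    txt \<open>Comparing absolute values at \<open>\<i>\<close> under the matrix \<open>(1, 0; p, 1)\<close> determines the weight.\<close>
    have weight: "r1 + rp = 2 * k"
    proof -
      define j where "j = of_nat p * \<i> + 1"
      have "norm j ^ 2 = real p ^ 2 + 1" by (simp add: j_def cmod_power2)
      then have j1: "norm j > 1" using p0
        by (metis less_add_same_cancel2 norm_ge_zero of_nat_0_less_iff one_power2 power2_less_imp_less zero_less_power)
      have "mat2 1 0 (int p) 1 \<in> Gamma1 p" by (simp add: Gamma1_def SL2Z_iff cong_def)
      from inv[OF this, of \<i>] have "j powi (- k) * ?f (\<i> / j) = ?f \<i>"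
        by (simp add: slash_def j_def)
      then have "norm j powi (- k) * norm (?f (\<i> / j)) = norm (?f \<i>)"
        by (metis norm_mult norm_power_int)
      moreover have "norm (?f (\<i> / j)) = norm j powr (of_int (r1 + rp) / 2) * norm (?f \<i>)"
        using norm_eta_quotient_Gamma0[of \<i> 1 1 0 p 1 r1 rp] p0
        by (simp add: j_def eta_quotient_apply)
      moreover have "norm (?f \<i>) \<noteq> 0" using eta_quotient_nonzero[of \<i> p] p0 by simp
      ultimately have "norm j powi (- k) * norm j powr (of_int (r1 + rp) / 2) = 1" by simp
      moreover have "norm j powi (- k) = norm j powr of_int (- k)"
        using j1 by (subst powr_real_of_int') auto
      ultimately have "norm j powr (of_int (- k) + of_int (r1 + rp) / 2) = 1"
        unfolding powr_add by simp
      then have "of_int (- k) + of_int (r1 + rp) / 2 = (0 :: real)"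
        using j1 by (simp only: powr_eq_one_iff)
      then have "real_of_int (r1 + rp) = real_of_int (2 * k)" by simp
      then show ?thesis by (simp only: of_int_eq_iff)
    qed
    have "24 dvd r1 + int p * rp"
    proof -
      have "mat2 1 1 0 1 \<in> Gamma1 p" by (simp add: Gamma1_def SL2Z_iff cong_def)
      from inv[OF this, of \<i>] have eq: "?f (\<i> + 1) = ?f \<i>" by (simp add: slash_def)
      have "?f (\<i> + 1) = dedekind_eta (\<i> + of_int 1) powi r1 * dedekind_eta (of_nat p * \<i> + of_int (int p)) powi rp"
        by (simp add: eta_quotient_apply algebra_simps)
      also have "\<dots> = epi (of_int r1 * (1 / 12) + of_int rp * (of_nat p / 12)) * ?f \<i>"
        unfolding dedekind_eta_add_int power_int_mult_distrib epi_power_int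
        by (simp add: eta_quotient_apply epi_add)
      finally have "epi (of_int r1 * (1 / 12) + of_int rp * (of_nat p / 12)) = 1"
        using eq eta_quotient_nonzero[of \<i> p r1 rp] p0 by simp
      then obtain n :: int where "of_int r1 * (1 / 12) + of_int rp * (of_nat p / 12) = (2 * of_int n :: complex)"
        using epi_eq_1_iff by blast
      then have "of_int (r1 + int p * rp) = (of_int (24 * n) :: complex)" by (simp add: field_simps)
      then have "r1 + int p * rp = 24 * n" by (simp only: of_int_eq_iff)
      then show ?thesis by simp
    qed
    moreover have "r1 + int p * rp > 0"
    proof -
      have A: "mat2 1 0 0 1 \<in> SL2Z" by (simp add: SL2Z_iff)
      from van[OF A] slash_eta_quotient_tendsto_0[OF A p(1) weight] show ?thesis by simp
    qed
    moreover have "int p * r1 + rp > 0"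
    proof -
      have A: "mat2 0 (-1) 1 0 \<in> SL2Z" by (simp add: SL2Z_iff)
      from van[OF A] slash_eta_quotient_tendsto_0[OF A p(1) weight] show ?thesis using p by simp
    qed
    ultimately show ?R using weight by blast
  }
  assume R: ?R
  then obtain s where s: "r1 + int p * rp = 24 * s" by (elim conjE dvdE)
  have "slash k A ?f z = ?f z" if A: "A \<in> Gamma1 p" and "z \<in> upper_half_plane" for A z
  proof -
    have z: "Im z > 0" using that by (simp add: upper_half_plane_def)
    define a b d where "a = A $ 1 $ 1" and "b = A $ 1 $ 2" and "d = A $ 2 $ 2"
    obtain c where c: "A $ 2 $ 1 = int p * c"
      using A by (auto simp: Gamma1_def cong_0_iff)
    have det: "a * d - b * (int p * c) = 1" and a: "[a = 1] (mod int p)"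
      using A c by (auto simp: Gamma1_def SL2Z_iff a_def b_def d_def)
    define j where "j = of_int (int p * c) * z + of_int d"
    have j0: "j \<noteq> 0" and \<gamma>: "Im ((of_int a * z + of_int b) / j) > 0"
      using moebius_Im_pos[OF det z] by (simp_all add: j_def)
    have "\<not> 3 dvd p" using p by (auto simp: prime_nat_iff)
    moreover have "odd p" using p by (simp add: prime_odd_nat)
    ultimately have "?f ((of_int a * z + of_int b) / j) = j powi k * ?f z"
      using eta_quotient_moebius[OF z _ _ det a _ s, of k] R
      unfolding eta_quotient_apply[OF \<gamma>] eta_quotient_apply[OF z] by (simp add: j_def)
    moreover have "slash k A ?f z = j powi (- k) * ?f ((of_int a * z + of_int b) / j)"
      unfolding slash_def c a_def b_def d_def j_def ..
    ultimately show ?thesis using j0 by (simp add: power_int_minus)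
  qed
  moreover have "vanishes_at_cusps k ?f"
    unfolding vanishes_at_cusps_def using slash_eta_quotient_tendsto_0[OF _ p(1)] R by simp
  moreover have "?f \<in> extensional upper_half_plane" by (simp add: eta_quotient_def)
  ultimately show ?L using eta_quotient_holomorphic[OF p0] by (simp add: cusp_forms_def)
qed

text \<open>If \<open>rp' < rp\<close>, the quotient of the two functions would be identically 1 and
  yet tend to 0 at infinity, its order there being a positive multiple of
  \<open>(p - 1) * (rp - rp')\<close>.\<close>

lemma eta_quotient_inj:
  assumes eq: "eta_quotient p r1 rp = eta_quotient p r1' rp'" and p: "p > 1" and sum: "r1 + rp = r1' + rp'"
  shows "rp = rp'"
proof (rule ccontr)
  assume ne: "rp \<noteq> rp'"
  have *: False if eq: "eta_quotient p r1 rp = eta_quotient p r1' rp'" and sum: "r1 + rp = r1' + rp'"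
    and lt: "rp' < rp" for r1 rp r1' rp'
  proof -
    have "dedekind_eta z powi (r1 - r1') * dedekind_eta (of_nat p * z) powi (rp - rp') = 1" if z: "Im z > 0" for z
    proof -
      have "dedekind_eta z \<noteq> 0" "dedekind_eta (of_nat p * z) \<noteq> 0"
        using z p by (auto intro!: dedekind_eta_nonzero)
      then show ?thesis using fun_cong[OF eq, of z]
        by (simp add: eta_quotient_apply[OF z] power_int_diff field_simps)
    qed
    then have "((\<lambda>z. norm (dedekind_eta z powi (r1 - r1') * dedekind_eta (of_nat p * z) powi (rp - rp'))) \<longlongrightarrow> 1)
        (filtercomap Im at_top)"
      by (intro tendsto_eventually eventually_mono[OF eventually_Im_pos]) simp
    moreover have "real_of_int (r1 - r1') + real p * real_of_int (rp - rp') = (real p - 1) * real_of_int (rp - rp')"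
    proof -
      have "r1 - r1' = - (rp - rp')" using sum by simp
      then show ?thesis by (simp add: algebra_simps)
    qed
    then have "((\<lambda>z. norm (dedekind_eta z powi (r1 - r1') * dedekind_eta (of_nat p * z) powi (rp - rp'))) \<longlongrightarrow> 0)
        (filtercomap Im at_top)"
      using p lt by (subst eta_product_tendsto_0_iff[of "real p"]) auto
    ultimately show False using tendsto_unique[OF filtercomap_Im_at_top_neq_bot] by fastforce
  qed
  show False using *[OF eq sum] *[OF eq[symmetric] sum[symmetric]] ne by linarith
qed

section \<open>Counting\<close>

text \<open>Write \<open>s = c + i * m\<close> and count \<open>i\<close>: the lower bound drops
  \<open>i = 0\<close> exactly when \<open>c = 0\<close>, the upper bound admits
  \<open>i = q\<close> exactly when \<open>c < r\<close>. For \<open>c = 0\<close> only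
  \<open>r = 0\<close> is listed, as \<open>r \<equiv> 2 * c\<close> modulo \<open>m\<close> in the
  application.\<close>

lemma card_residue_class_below:
  fixes m c q r :: int
  assumes "0 < m" "0 \<le> c" "c < m" "0 \<le> r" "r < m" "0 \<le> q"
  defines "S \<equiv> {s. 1 \<le> s \<and> s < q * m + r \<and> [s = c] (mod m)}"
  shows "finite S" "0 < c \<Longrightarrow> c < r \<Longrightarrow> int (card S) = q + 1"
    "0 < c \<Longrightarrow> r \<le> c \<Longrightarrow> int (card S) = q"
    "c = 0 \<Longrightarrow> r = 0 \<Longrightarrow> 0 < q \<Longrightarrow> int (card S) = q - 1"
proof -
  have inj: "inj_on (\<lambda>i. c + i * m) I" for I using assms by (auto simp: inj_on_def)
  have S: "S = (\<lambda>i. c + i * m) ` {i. 1 \<le> c + i * m \<and> c + i * m < q * m + r}"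
  proof (rule Set.set_eqI)
    fix s
    have "[s = c] (mod m) \<longleftrightarrow> (\<exists>i. s = c + i * m)"
      by (metis cong_iff_lin cong_sym mult.commute)
    then show "s \<in> S \<longleftrightarrow> s \<in> (\<lambda>i. c + i * m) ` {i. 1 \<le> c + i * m \<and> c + i * m < q * m + r}"
      by (auto simp: S_def)
  qed
  have upper: "c + i * m < q * m + r \<longleftrightarrow> (if c < r then i \<le> q else i < q)" for i
  proof -
    have "i < q \<Longrightarrow> (i + 1) * m \<le> q * m" "q < i \<Longrightarrow> (q + 1) * m \<le> i * m"
      using assms by (auto intro: mult_right_mono)
    then show ?thesis using assms by (cases i q rule: linorder_cases) (auto simp: algebra_simps)
  qed
  have lower: "1 \<le> c + i * m \<longleftrightarrow> (if c = 0 then 1 \<le> i else 0 \<le> i)" for i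
  proof -
    have A: "m \<le> i * m" if "1 \<le> i" using mult_right_mono[OF that, of m] assms by simp
    have B: "i * m \<le> - m" if "i \<le> -1" using mult_right_mono[OF that, of m] assms by simp
    consider "1 \<le> i" | "i = 0" | "i \<le> -1" by linarith
    then show ?thesis
    proof cases
      case 1
      have "1 \<le> c + i * m" using A[OF 1] assms(1,2) by linarith
      then show ?thesis using 1 by (smt (verit))
    next
      case 2 then show ?thesis using assms by auto
    next
      case 3 then show ?thesis using B[OF 3] assms by auto
    qed
  qed
  have S': "S = (\<lambda>i. c + i * m) ` {i. (if c = 0 then 1 \<le> i else 0 \<le> i) \<and> (if c < r then i \<le> q else i < q)}"
    unfolding S upper lower ..
  have card: "card S = card {i. (if c = 0 then 1 \<le> i else 0 \<le> i) \<and> (if c < r then i \<le> q else i < q)}"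
    unfolding S' by (rule card_image[OF inj])
  have "{i. (if c = 0 then 1 \<le> i else 0 \<le> i) \<and> (if c < r then i \<le> q else i < q)} \<subseteq> {0..q}"
    by (auto split: if_splits)
  then show "finite S" unfolding S' using finite_subset by blast
  show "int (card S) = q + 1" if "0 < c" "c < r"
  proof -
    have "{i. (if c = 0 then 1 \<le> i else 0 \<le> i) \<and> (if c < r then i \<le> q else i < q)} = {0..q}"
      using that by auto
    then show ?thesis using assms unfolding card by simp
  qed
  show "int (card S) = q" if "0 < c" "r \<le> c"
  proof -
    have "{i. (if c = 0 then 1 \<le> i else 0 \<le> i) \<and> (if c < r then i \<le> q else i < q)} = {0..<q}"
      using that by auto
    then show ?thesis using assms unfolding card by simp
  qed
  show "int (card S) = q - 1" if "c = 0" "r = 0" "0 < q"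
  proof -
    have "{i. (if c = 0 then 1 \<le> i else 0 \<le> i) \<and> (if c < r then i \<le> q else i < q)} = {1..<q}"
      using that by auto
    then show ?thesis using that unfolding card by simp
  qed
qed

text \<open>The parameter \<open>s\<close> is the order at infinity,
  \<open>r1 + p * rp = 24 * s\<close>, and \<open>K - s\<close> is the order at 0. With
  \<open>r1 = 2 * k - rp\<close> and \<open>p - 1 = 2 * h * m\<close> the equation becomes
  \<open>k' + m * rp = e * s\<close>, so \<open>s\<close> determines \<open>rp\<close> when the
  division by \<open>m\<close> is exact.\<close>

lemma bij_betw_cuspidal_eta_quotients:
  fixes e h k k' m K :: nat
  assumes p: "prime p" "p > 3" and k: "k = h * k'" and he: "h * e = 12"
    and hm: "p - 1 = 2 * h * m" and K: "12 * K = k * (p + 1)"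
  shows "bij_betw (\<lambda>s. eta_quotient p (2 * int k - (int e * s - int k') div int m) ((int e * s - int k') div int m))
    {s. 1 \<le> s \<and> s < int K \<and> int m dvd int e * s - int k'} (cuspidal_eta_quotients p (int k))"
    (is "bij_betw ?f ?S _")
proof -
  define P where "P = int p"
  have "p = 2 * h * m + 1" using hm p by linarith
  then have pm: "P = 2 * int h * int m + 1" by (simp add: P_def)
  have h0: "h > 0" using he by (cases h) auto
  have m0: "m > 0" using hm p by (cases m) auto
  have e24: "24 = 2 * int h * int e" using arg_cong[OF he, of int] by (simp add: mult.commute)
  have K': "12 * int K = int h * int k' * (P + 1)" using arg_cong[OF K, of int] by (simp add: k P_def algebra_simps)
  have iff: "eta_quotient p r1 rp \<in> cusp_forms (int k) (Gamma1 p) \<longleftrightarrow>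
      r1 = 2 * int k - rp \<and> (\<exists>s\<in>?S. rp = (int e * s - int k') div int m)" for r1 rp
  proof (cases "r1 = 2 * int k - rp")
    case True
    have 1: "r1 + P * rp = 2 * int h * (int k' + int m * rp)"
      unfolding True by (simp add: pm k algebra_simps)
    have 2: "P * r1 + rp = 24 * int K - (r1 + P * rp)"
      using K' unfolding True k by (simp add: algebra_simps)
    have 24: "24 dvd r1 + P * rp \<longleftrightarrow> (\<exists>s. int k' + int m * rp = int e * s)"
      unfolding 1 e24 using h0 by (auto simp: dvd_def mult.assoc)
    have s_iff: "rp = (int e * s - int k') div int m \<and> int m dvd int e * s - int k' \<longleftrightarrow> int k' + int m * rp = int e * s" for s
    proof
      assume "rp = (int e * s - int k') div int m \<and> int m dvd int e * s - int k'"
      then have "int m * rp = int e * s - int k'" by simp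
      then show "int k' + int m * rp = int e * s" by simp
    next
      assume "int k' + int m * rp = int e * s"
      then have "int e * s - int k' = int m * rp" by simp
      then show "rp = (int e * s - int k') div int m \<and> int m dvd int e * s - int k'" using m0 by simp
    qed
    have pos: "r1 + P * rp > 0 \<and> P * r1 + rp > 0 \<longleftrightarrow> 1 \<le> s \<and> s < int K" if "int k' + int m * rp = int e * s" for s
    proof -
      have "r1 + P * rp = 24 * s" unfolding 1 that e24 by simp
      then show ?thesis unfolding 2 by auto
    qed
    have "eta_quotient p r1 rp \<in> cusp_forms (int k) (Gamma1 p) \<longleftrightarrow>
      24 dvd r1 + P * rp \<and> r1 + P * rp > 0 \<and> P * r1 + rp > 0"
      unfolding eta_quotient_cusp_form_iff[OF p] P_def using True by simp
    also have "\<dots> \<longleftrightarrow> (\<exists>s. int k' + int m * rp = int e * s \<and> 1 \<le> s \<and> s < int K)"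
      unfolding 24 using pos by blast
    also have "\<dots> \<longleftrightarrow> (\<exists>s\<in>?S. rp = (int e * s - int k') div int m)"
      unfolding s_iff[symmetric] by blast
    finally show ?thesis using True by simp
  next
    case False
    then show ?thesis unfolding eta_quotient_cusp_form_iff[OF p] by auto
  qed
  show ?thesis unfolding bij_betw_def
  proof
    show "inj_on ?f ?S"
    proof (rule inj_onI)
      fix s t assume s: "s \<in> ?S" and t: "t \<in> ?S" and st: "?f s = ?f t"
      have "(int e * s - int k') div int m = (int e * t - int k') div int m"
        by (rule eta_quotient_inj[OF st]) (use p in simp_all)
      then have "int e * s - int k' = int e * t - int k'"
        using s t by (metis (no_types, lifting) dvd_div_mult_self mem_Collect_eq)
      moreover have "e > 0" using he by (cases e) auto
      ultimately show "s = t" by simp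
    qed
    show "?f ` ?S = cuspidal_eta_quotients p (int k)"
    proof (intro subset_antisym subsetI)
      fix F assume "F \<in> ?f ` ?S"
      then obtain s where "s \<in> ?S" and F: "F = ?f s" by (elim imageE)
      then have "F \<in> cusp_forms (int k) (Gamma1 p)" unfolding F iff by (intro conjI refl bexI[of _ s])
      then show "F \<in> cuspidal_eta_quotients p (int k)"
        unfolding cuspidal_eta_quotients_def F by (intro IntI CollectI exI[of _ "2 * int k - _"] exI) (rule refl)
    next
      fix F assume "F \<in> cuspidal_eta_quotients p (int k)"
      then obtain r1 rp where F: "F = eta_quotient p r1 rp" "eta_quotient p r1 rp \<in> cusp_forms (int k) (Gamma1 p)"
        unfolding cuspidal_eta_quotients_def by blast
      then obtain s where "s \<in> ?S" "rp = (int e * s - int k') div int m" "r1 = 2 * int k - rp"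
        unfolding iff by (elim conjE bexE)
      then show "F \<in> ?f ` ?S" unfolding F(1) by (intro image_eqI[of _ _ s]) simp_all
    qed
  qed
qed

theorem theorem1p3:
  fixes p h k k' m K :: nat and c r :: int
  assumes "prime p" and "p > 3"
    and "real h = 1 / 2 * real (gcd (p - 1) 24)"
    and "k = h * k'" and "k > 0"
    and "real m = (real p - 1) / (2 * real h)"
    and "K = k * (p + 1) div 12"
    and "r = int K - \<lfloor>real K / real m\<rfloor> * int m"
    and "c = (int k' * modular_inverse (int m) (int (12 div h))) mod int m"
  shows "12 dvd k * (p + 1) \<and> h dvd 12 \<and> coprime (12 div h) m \<and>
    finite (cuspidal_eta_quotients p (int k)) \<and>
    (c = r \<longrightarrow> real (card (cuspidal_eta_quotients p (int k))) =
       real (k * (p + 1)) / (12 * ((real p - 1) / (2 * real h))) - 1) \<and>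
    (c < r \<longrightarrow> int (card (cuspidal_eta_quotients p (int k))) =
       \<lceil>real (k * (p + 1)) / (12 * ((real p - 1) / (2 * real h)))\<rceil>) \<and>
    (c > r \<longrightarrow> int (card (cuspidal_eta_quotients p (int k))) =
       \<lfloor>real (k * (p + 1)) / (12 * ((real p - 1) / (2 * real h)))\<rfloor>)"
proof -
  \<comment> \<open>The hypotheses over the reals are first turned into the identities
    \<open>G = 2 * h\<close> and \<open>p - 1 = 2 * h * m\<close> of natural numbers.\<close>
  define G where "G = gcd (p - 1) 24"
  have "real (2 * h) = real G" using assms(3) by (simp add: G_def)
  then have G: "G = 2 * h" by (simp only: of_nat_eq_iff)
  have h0: "h > 0" using assms(4,5) by (cases h) auto
  have "real (p - 1) = real (2 * h * m)"
    using assms(2,6) h0 by (simp add: of_nat_diff field_simps)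
  then have hm: "p - 1 = 2 * h * m" by (simp only: of_nat_eq_iff)
  have m0: "m > 0" using hm assms(2) by (cases m) auto
  have "G dvd 24" by (simp add: G_def)
  then obtain e where "24 = G * e" by (elim dvdE)
  then have he: "h * e = 12" using G by (simp add: mult.commute)
  have e: "12 div h = e" using he h0 by (metis nonzero_mult_div_cancel_left less_irrefl)
  have "2 * h * e = 24" using he by (simp add: mult.commute)
  \<comment> \<open>Dividing \<open>gcd (p - 1) 24 = 2 * h\<close> by \<open>2 * h\<close> shows
    that \<open>m\<close> and \<open>e\<close> are coprime.\<close>
  then have "gcd (2 * h * m) (2 * h * e) = 2 * h" using G by (simp only: G_def hm)
  then have "2 * h * gcd m e = 2 * h * 1" by (simp only: gcd_mult_distrib_nat mult_1_right)
  then have "gcd e m = 1" using h0 by (simp only: mult_cancel1 gcd.commute[of e m]) simp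
  then have cop: "coprime e m" unfolding coprime_iff_gcd_eq_1 .
  have "24 dvd (p - 1) * (p + 1)"
  proof -
    have "odd p" using assms(1,2) by (simp add: prime_odd_nat)
    then obtain M where M: "p = 2 * M + 1" by (elim oddE)
    have "\<not> 3 dvd p" using assms(1,2) by (auto simp: prime_nat_iff)
    then have "3 dvd p - 1 \<or> 3 dvd p + 1" using M by presburger
    then have "3 dvd (p - 1) * (p + 1)" using dvd_mult dvd_mult2 by blast
    moreover have "(p - 1) * (p + 1) = 4 * (M * (M + 1))" using M by simp
    moreover have "2 dvd M * (M + 1)" by simp
    ultimately show ?thesis by presburger
  qed
  \<comment> \<open>Both arguments are multiples of 24, and their gcd is
    \<open>(p + 1) * gcd (p - 1) 24\<close>; hence \<open>12 dvd h * (p + 1)\<close>.\<close>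
  then have "24 dvd gcd ((p - 1) * (p + 1)) (24 * (p + 1))" by simp
  also have "gcd ((p - 1) * (p + 1)) (24 * (p + 1)) = 2 * h * (p + 1)"
    unfolding G[symmetric] G_def by (simp only: gcd_mult_distrib_nat mult.commute[of _ "p + 1"])
  finally have "2 * 12 dvd 2 * (h * (p + 1))" by (simp only: mult.assoc) simp
  then have "12 dvd h * (p + 1)" by (subst (asm) dvd_times_left_cancel_iff) auto
  then have d12: "12 dvd k * (p + 1)" unfolding assms(4)
    using dvd_mult[of 12 "h * (p + 1)" k'] by (simp only: mult_ac)
  then have K: "12 * K = k * (p + 1)" using assms(7) by simp
  have K0: "K > 0" using K assms(5) by (cases K) auto
  \<comment> \<open>By the choice of the modular inverse, \<open>e * c \<equiv> k'\<close> modulo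
    \<open>m\<close>, so integrality of \<open>rp\<close> in the bijection says that
    \<open>s\<close> lies in the class of \<open>c\<close>.\<close>
  have ce: "int m dvd int e * s - int k' \<longleftrightarrow> [s = c] (mod int m)" for s
  proof -
    have cop': "coprime (int e) (int m)" using cop by simp
    have "[int e * c = int e * (int k' * modular_inverse (int m) (int e))] (mod int m)"
      unfolding assms(9) e by (intro cong_mult cong_refl) simp
    also have "int e * (int k' * modular_inverse (int m) (int e)) = int k' * (int e * modular_inverse (int m) (int e))"
      by (simp add: mult_ac)
    also have "[int k' * (int e * modular_inverse (int m) (int e)) = int k' * 1] (mod int m)"
      by (intro cong_mult cong_refl cong_modular_inverse1 cop')
    finally have ec: "[int e * c = int k'] (mod int m)" by simp
    have "int m dvd int e * s - int k' \<longleftrightarrow> [int e * s = int k'] (mod int m)"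
      by (simp add: cong_iff_dvd_diff)
    also have "\<dots> \<longleftrightarrow> [int e * s = int e * c] (mod int m)"
      using ec cong_sym cong_trans by blast
    also have "\<dots> \<longleftrightarrow> [s = c] (mod int m)"
      using cong_mult_lcancel[of "int e" "int m"] cop' by (simp add: coprime_commute)
    finally show ?thesis .
  qed
  define q where "q = int K div int m"
  have "\<lfloor>real K / real m\<rfloor> = q" unfolding q_def by (metis floor_divide_of_int_eq of_int_of_nat_eq)
  then have r: "r = int K mod int m" and Kqr: "int K = q * int m + r"
    using assms(8) by (simp_all add: q_def minus_div_mult_eq_mod)
  have r0: "0 \<le> r" "r < int m" and c0: "0 \<le> c" "c < int m" and q0: "0 \<le> q"
    using m0 unfolding r assms(9) q_def by (simp_all add: pos_imp_zdiv_nonneg_iff)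
  have bij: "bij_betw (\<lambda>s. eta_quotient p (2 * int k - (int e * s - int k') div int m) ((int e * s - int k') div int m))
    {s. 1 \<le> s \<and> s < q * int m + r \<and> [s = c] (mod int m)} (cuspidal_eta_quotients p (int k))"
    using bij_betw_cuspidal_eta_quotients[OF assms(1,2,4) he hm K] unfolding ce Kqr .
  note card = card_residue_class_below[of "int m" c r q, OF _ c0 r0 q0, unfolded bij_betw_same_card[OF bij]]
  have fin: "finite (cuspidal_eta_quotients p (int k))"
    using card_residue_class_below(1)[of "int m" c r q, OF _ c0 r0 q0] m0 bij_betw_finite[OF bij] by simp
  txt \<open>This forces \<open>c = 0\<close> whenever \<open>c = r\<close>.\<close>
  have rc: "int m dvd r - 2 * c"
  proof -
    have "12 * int K = int h * int k' * (int p + 1)" using arg_cong[OF K, of int] by (simp add: assms(4) algebra_simps)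
    moreover have "p = 2 * h * m + 1" using hm assms(2) by linarith
    then have "int p + 1 = 2 * int h * int m + 2" by simp
    moreover have "int h * int e = 12" using arg_cong[OF he, of int] by simp
    \<comment> \<open>Since \<open>p + 1 \<equiv> 2\<close> modulo \<open>m\<close>, this leads to
      \<open>e * K \<equiv> 2 * k' \<equiv> 2 * e * c\<close>; cancelling \<open>e\<close> gives
      \<open>K \<equiv> 2 * c\<close>.\<close>
    ultimately have "int h * (int e * int K) = int h * (2 * int k' + int m * (2 * int h * int k'))"
      by (simp add: algebra_simps)
    then have "int e * int K = 2 * int k' + int m * (2 * int h * int k')" using h0 by simp
    then have "int m dvd int e * int K - 2 * int k'" by simp
    moreover have "int m dvd 2 * (int e * c - int k')" using ce[of c] by (intro dvd_mult) simp
    ultimately have "int m dvd (int e * int K - 2 * int k') - 2 * (int e * c - int k')" by (rule dvd_diff)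
    then have "int m dvd int e * (int K - 2 * c)" by (simp add: algebra_simps)
    moreover have "coprime (int m) (int e)" using cop by (simp add: coprime_commute)
    ultimately have "int m dvd int K - 2 * c" using coprime_dvd_mult_right_iff by blast
    then have "int m dvd (int K - 2 * c) - q * int m" by simp
    then show ?thesis unfolding Kqr by simp
  qed
  have frac: "real (k * (p + 1)) / (12 * ((real p - 1) / (2 * real h))) = of_int q + of_int r / real m"
  proof -
    have "real (k * (p + 1)) = 12 * real K" using arg_cong[OF K, of real] by simp
    moreover have "real K = of_int q * real m + of_int r"
      using arg_cong[OF Kqr, of real_of_int] by simp
    ultimately show ?thesis unfolding assms(6)[symmetric] using m0 by (simp add: field_simps)
  qed
  have eq: "real (card (cuspidal_eta_quotients p (int k))) = of_int q + of_int r / real m - 1" if "c = r"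
  proof -
    have "int m dvd c" using rc that by simp
    then have "c = 0" using c0 zdvd_not_zless[of c "int m"] by linarith
    \<comment> \<open>With \<open>r = 0\<close>, positivity of \<open>K\<close> rules out
      \<open>q = 0\<close>, where the count \<open>q - 1\<close> would be negative.\<close>
    moreover have "q > 0" using Kqr K0 \<open>c = 0\<close> that q0 by (cases "q = 0") auto
    ultimately have "int (card (cuspidal_eta_quotients p (int k))) = q - 1" using card(4) m0 that by simp
    then have "real_of_int (int (card (cuspidal_eta_quotients p (int k)))) = real_of_int (q - 1)" by simp
    then show ?thesis using \<open>c = 0\<close> that by simp
  qed
  have lt: "int (card (cuspidal_eta_quotients p (int k))) = \<lceil>of_int q + of_int r / real m\<rceil>" if "c < r"
  proof -
    \<comment> \<open>If \<open>c = 0\<close>, then \<open>m\<close> would divide \<open>r\<close>,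
      although \<open>0 < r < m\<close>.\<close>
    have "c \<noteq> 0" using rc that r0 c0 zdvd_not_zless[of r "int m"] by auto
    then have "int (card (cuspidal_eta_quotients p (int k))) = q + 1" using card(2) m0 that c0 by simp
    moreover have "\<lceil>of_int q + of_int r / real m\<rceil> = q + 1"
      using r0 c0 that m0 by (intro ceiling_unique) (auto simp: field_simps)
    ultimately show ?thesis by simp
  qed
  have gt: "int (card (cuspidal_eta_quotients p (int k))) = \<lfloor>of_int q + of_int r / real m\<rfloor>" if "c > r"
  proof -
    have "int (card (cuspidal_eta_quotients p (int k))) = q" using card(3) m0 that r0 by simp
    moreover have "\<lfloor>of_int q + of_int r / real m\<rfloor> = q"
      using r0 m0 by (intro floor_unique) (auto simp: field_simps)
    ultimately show ?thesis by simp
  qed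
  show ?thesis
    unfolding frac e using d12 he cop fin eq lt gt by (auto simp: dvd_def)
qed

end
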